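(* Let $p>3$ be a prime, let $G=(3,3\,|\,3,p)$ with generators $x,y$ as in its presentation, and let $H=\langle x^2y,\,xy^2\rangle\le G$. Put $h(i)=x^2y(xy^2)^i$ for $0\le i<p$, $h(\infty)=xy^2$, and $H(i)=\langle h(i)\rangle$ for $i\in\{0,\dots,p-1,\infty\}$. For $0\le k,l<p$ put $g(k,l)=(x^2y)^{-k}(xy^2)^{-l}\,x\,(x^2y)^k(xy^2)^l$ and $G(k,l)=\langle g(k,l)\rangle$. Then: (1) The minimal (nontrivial) subgroups of $G$ are the groups $H(i)\cong C_p$ for $i\in\{0,\dots,p-1,\infty\}$ and $G(k,l)\cong C_3$ for $0\le k,l<p$; and $H(i)\vee H(j)=H\cong C_p\times C_p$ for all $i\ne j$ in $\{0,\dots,p-1,\infty\}$. (2) If $3$ does not divide $p-1$, then $G$ has no subgroups other than the trivial subgroup, $G$, $H$, the $H(i)$ and the $G(k,l)$. (3) If $3$ divides $p-1$, then besides the subgroups listed in (2) there are exactly $2p$ additional subgroups of $G$; they are non-abelian maximal subgroups of order $3p$, with $p$ of them for each $i$ satisfying $1<i<p$ and $i^3\equiv 1\pmod p$. They can be listed as $K(i,l)=H(i)\vee G(0,l)$, where $1<i<p$, $i^3\equiv 1 \pmod p$ and $0\le l<p$. (4) Let $0\le k',l'<p$. If $1<i<p$ and $i^3\equiv1\pmod p$, then for $0\le l<p$ we have $H(i)\vee G(k',l')=K(i,l)$ if and only if $l'-l\equiv ik'\pmod p$. For every other $i\in\{0,\dots,p-1,\infty\}$, $H(i)\vee G(k',l')=G$.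 (5) Let $0\le k,l,k',l'<p$ with $(k,l)\ne(k',l')$. For $1<i<p$ with $i^3\equiv 1\pmod p$, we have $G(k,l)\vee G(k',l')=H(i)\vee G(k,l)$ if and only if $l'-l\equiv (k'-k)i\pmod p$. If there is no $i$ with $1<i<p$, $i^3\equiv1\pmod p$ and $l'-l\equiv (k'-k)i\pmod p$, then $G(k,l)\vee G(k',l')=G$. Moreover, the group $(3,3\,|\,3,2)$ is isomorphic to $A_4$, the alternating group on $4$ points, and $(3,3\,|\,3,3)$ is the unique (up to isomorphism) non-abelian group of order $27$ and exponent $3$.
   Context: For a positive integer $n$, $(3,3\,|\,3,n)$ denotes the group given by the presentation $\langle x,y \mid x^3=y^3=(xy)^3=(x^{-1}y)^n=1\rangle$. $C_m$ denotes the cyclic group of order $m$. For subgroups $A,B$ of a group, $A\vee B$ denotes the subgroup generated by $A\cup B$. *)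

theory Defs
  imports
    "HOL-Algebra.Sym_Groups"
    "HOL-Algebra.Elementary_Groups"
    "HOL-Number_Theory.Cong"
    "HOL-Library.Extended_Nat"
begin

section \<open>Groups given by generators and relators\<close>

text \<open>
  A word is a list of letters; the letter \<open>(a, True)\<close> stands for the generator \<open>a\<close> and
  \<open>(a, False)\<close> for its formal inverse.  The presented group consists of all words modulo the
  least congruence that cancels adjacent inverse letters and deletes relators.  All elements of
  the type \<open>'a\<close> are generators.
\<close>

type_synonym 'a word = "('a \<times> bool) list"

inductive word_eq :: "'a word set \<Rightarrow> 'a word \<Rightarrow> 'a word \<Rightarrow> bool" for R where
  cancel: "word_eq R (u @ [(a, e), (a, \<not> e)] @ v) (u @ v)"
| relator: "r \<in> R \<Longrightarrow> word_eq R (u @ r @ v) (u @ v)"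
| refl: "word_eq R u u"
| sym: "word_eq R u v \<Longrightarrow> word_eq R v u"
| trans: "word_eq R u v \<Longrightarrow> word_eq R v w \<Longrightarrow> word_eq R u w"

definition word_class :: "'a word set \<Rightarrow> 'a word \<Rightarrow> 'a word set" where
  "word_class R u = {v. word_eq R u v}"

definition presented_group :: "'a word set \<Rightarrow> 'a word set monoid" where
  "presented_group R =
     \<lparr>carrier = range (word_class R),
      mult = (\<lambda>A B. \<Union>u\<in>A. \<Union>v\<in>B. word_class R (u @ v)),
      one = word_class R []\<rparr>"

definition generator :: "'a word set \<Rightarrow> 'a \<Rightarrow> 'a word set" where
  "generator R a = word_class R [(a, True)]"

lemma word_eq_append_right: "word_eq R u v \<Longrightarrow> word_eq R (u @ w) (v @ w)"
proof (induction rule: word_eq.induct)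
  case (cancel u a e v)
  show ?case using word_eq.cancel[of R u a e "v @ w"] by simp
next
  case (relator r u v)
  then show ?case using word_eq.relator[of r R u "v @ w"] by simp
qed (blast intro: word_eq.refl word_eq.sym word_eq.trans)+

lemma word_eq_append_left: "word_eq R u v \<Longrightarrow> word_eq R (w @ u) (w @ v)"
proof (induction rule: word_eq.induct)
  case (cancel u a e v)
  show ?case using word_eq.cancel[of R "w @ u" a e v] by simp
next
  case (relator r u v)
  then show ?case using word_eq.relator[of r R "w @ u" v] by simp
qed (blast intro: word_eq.refl word_eq.sym word_eq.trans)+

lemma word_eq_append: "word_eq R u u' \<Longrightarrow> word_eq R v v' \<Longrightarrow> word_eq R (u @ v) (u' @ v')"
  by (blast intro: word_eq_append_left word_eq_append_right word_eq.trans)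

lemma word_class_eq_iff: "word_class R u = word_class R v \<longleftrightarrow> word_eq R u v"
  unfolding word_class_def by (blast intro: word_eq.refl word_eq.sym word_eq.trans)

lemma mult_presented_group:
  "word_class R u \<otimes>\<^bsub>presented_group R\<^esub> word_class R v = word_class R (u @ v)"
proof -
  have *: "word_class R (u' @ v') = word_class R (u @ v)"
    if "u' \<in> word_class R u" "v' \<in> word_class R v" for u' v'
    unfolding word_class_eq_iff
    by (rule word_eq.sym, rule word_eq_append) (use that in \<open>simp_all add: word_class_def\<close>)
  have mem: "u \<in> word_class R u" "v \<in> word_class R v"
    by (simp_all add: word_class_def word_eq.refl)
  have "(\<Union>u'\<in>word_class R u. \<Union>v'\<in>word_class R v. word_class R (u' @ v')) =
      (\<Union>u'\<in>word_class R u. \<Union>v'\<in>word_class R v. word_class R (u @ v))"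
    by (intro SUP_cong HOL.refl *)
  also have "\<dots> = word_class R (u @ v)"
    using mem by auto
  finally show ?thesis
    by (simp add: presented_group_def)
qed

lemma one_presented_group: "\<one>\<^bsub>presented_group R\<^esub> = word_class R []"
  by (simp add: presented_group_def)

lemma carrier_presented_group: "carrier (presented_group R) = range (word_class R)"
  by (simp add: presented_group_def)

definition word_inv :: "'a word \<Rightarrow> 'a word" where
  "word_inv u = rev (map (\<lambda>(a, e). (a, \<not> e)) u)"

lemma word_inv_left: "word_eq R (word_inv u @ u) []"
proof (induction u)
  case Nil
  show ?case by (simp add: word_inv_def word_eq.refl)
next
  case (Cons l u)
  obtain a e where l: "l = (a, e)" by fastforce
  have "word_eq R (word_inv u @ [(a, \<not> e), (a, \<not> \<not> e)] @ u) (word_inv u @ u)"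
    by (rule word_eq.cancel)
  then show ?case
    using Cons.IH l by (auto simp: word_inv_def intro: word_eq.trans)
qed

lemma group_presented_group: "group (presented_group R)"
proof (rule groupI)
  fix A assume "A \<in> carrier (presented_group R)"
  then obtain u where "A = word_class R u"
    by (auto simp: carrier_presented_group)
  then have "word_class R (word_inv u) \<otimes>\<^bsub>presented_group R\<^esub> A = \<one>\<^bsub>presented_group R\<^esub>"
    by (simp add: mult_presented_group one_presented_group word_class_eq_iff word_inv_left)
  then show "\<exists>B\<in>carrier (presented_group R). B \<otimes>\<^bsub>presented_group R\<^esub> A = \<one>\<^bsub>presented_group R\<^esub>"
    by (auto simp: carrier_presented_group)
qed (auto simp: carrier_presented_group mult_presented_group one_presented_group)

fun word_eval :: "('b, 'c) monoid_scheme \<Rightarrow> ('a \<Rightarrow> 'b) \<Rightarrow> 'a word \<Rightarrow> 'b" where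
  "word_eval K f [] = \<one>\<^bsub>K\<^esub>"
| "word_eval K f ((a, e) # u) = (if e then f a else inv\<^bsub>K\<^esub> f a) \<otimes>\<^bsub>K\<^esub> word_eval K f u"

lemma presented_group_universal:
  assumes K: "group K" and f: "\<And>a. f a \<in> carrier K"
    and R: "\<And>r. r \<in> R \<Longrightarrow> word_eval K f r = \<one>\<^bsub>K\<^esub>"
  shows "\<exists>\<phi>\<in>hom (presented_group R) K. \<forall>a. \<phi> (generator R a) = f a"
proof -
  interpret K: group K by fact
  have closed: "word_eval K f u \<in> carrier K" for u
    by (induction u) (auto simp: f)
  have app: "word_eval K f (u @ v) = word_eval K f u \<otimes>\<^bsub>K\<^esub> word_eval K f v" for u v
    by (induction u) (auto simp: f closed K.m_assoc)
  have respects: "word_eval K f u = word_eval K f v" if "word_eq R u v" for u v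
    using that
  proof (induction rule: word_eq.induct)
    case (cancel u a e v)
    have "f a \<otimes>\<^bsub>K\<^esub> (inv\<^bsub>K\<^esub> f a \<otimes>\<^bsub>K\<^esub> word_eval K f v) = word_eval K f v"
      "inv\<^bsub>K\<^esub> f a \<otimes>\<^bsub>K\<^esub> (f a \<otimes>\<^bsub>K\<^esub> word_eval K f v) = word_eval K f v"
      using K.m_assoc[OF f K.inv_closed[OF f] closed, of a a v]
        K.m_assoc[OF K.inv_closed[OF f] f closed, of a a v]
      by (simp_all add: f closed)
    then show ?case by (cases e) (simp_all add: app)
  next
    case (relator r u v)
    then show ?case by (simp add: app closed R)
  qed simp_all
  define \<phi> where "\<phi> A = word_eval K f (SOME u. A = word_class R u)" for A
  have \<phi>: "\<phi> (word_class R u) = word_eval K f u" for u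
  proof -
    have "word_class R u = word_class R (SOME v. word_class R u = word_class R v)"
      by (rule someI) (rule HOL.refl)
    then show ?thesis
      unfolding \<phi>_def word_class_eq_iff by (rule respects[symmetric])
  qed
  have "\<phi> \<in> hom (presented_group R) K"
    by (rule homI) (auto simp: carrier_presented_group mult_presented_group \<phi> closed app)
  moreover have "\<phi> (generator R a) = f a" for a
    by (simp add: generator_def \<phi> f)
  ultimately show ?thesis by blast
qed


section \<open>Subgroups and exponents\<close>

definition subgroup_join :: "('a, 'b) monoid_scheme \<Rightarrow> 'a set \<Rightarrow> 'a set \<Rightarrow> 'a set" where
  "subgroup_join G A B = generate G (A \<union> B)"

definition minimal_subgroup :: "'a set \<Rightarrow> ('a, 'b) monoid_scheme \<Rightarrow> bool" where
  "minimal_subgroup A G \<longleftrightarrow>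
     subgroup A G \<and> A \<noteq> {\<one>\<^bsub>G\<^esub>} \<and>
     (\<forall>B. subgroup B G \<and> B \<subseteq> A \<longrightarrow> B = {\<one>\<^bsub>G\<^esub>} \<or> B = A)"

definition maximal_subgroup :: "'a set \<Rightarrow> ('a, 'b) monoid_scheme \<Rightarrow> bool" where
  "maximal_subgroup A G \<longleftrightarrow>
     subgroup A G \<and> A \<noteq> carrier G \<and>
     (\<forall>B. subgroup B G \<and> A \<subseteq> B \<longrightarrow> B = A \<or> B = carrier G)"

text \<open>
  For a group of infinite exponent the following value is unspecified; it is only used together
  with finiteness of the group.
\<close>

definition group_exponent :: "('a, 'b) monoid_scheme \<Rightarrow> nat" where
  "group_exponent G = (LEAST n. 0 < n \<and> (\<forall>g\<in>carrier G. g [^]\<^bsub>G\<^esub> n = \<one>\<^bsub>G\<^esub>))"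

definition nonabelian_27_exp_3 :: "('a, 'b) monoid_scheme \<Rightarrow> bool" where
  "nonabelian_27_exp_3 G \<longleftrightarrow>
     group G \<and> \<not> comm_group G \<and> order G = 27 \<and> group_exponent G = 3"


section \<open>The groups (3,3|3,n)\<close>

datatype xy = X | Y

definition relators_333 :: "nat \<Rightarrow> xy word set" where
  "relators_333 n =
     {replicate 3 (X, True),
      replicate 3 (Y, True),
      concat (replicate 3 [(X, True), (Y, True)]),
      concat (replicate n [(X, False), (Y, True)])}"

definition grp :: "nat \<Rightarrow> xy word set monoid" where
  "grp n = presented_group (relators_333 n)"

definition gx :: "nat \<Rightarrow> xy word set" where
  "gx n = generator (relators_333 n) X"

definition gy :: "nat \<Rightarrow> xy word set" where
  "gy n = generator (relators_333 n) Y"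

definition x2y :: "nat \<Rightarrow> xy word set" where
  "x2y n = gx n [^]\<^bsub>grp n\<^esub> (2::nat) \<otimes>\<^bsub>grp n\<^esub> gy n"

definition xy2 :: "nat \<Rightarrow> xy word set" where
  "xy2 n = gx n \<otimes>\<^bsub>grp n\<^esub> gy n [^]\<^bsub>grp n\<^esub> (2::nat)"

definition H_sub :: "nat \<Rightarrow> xy word set set" where
  "H_sub n = generate (grp n) {x2y n, xy2 n}"

definition indices :: "nat \<Rightarrow> enat set" where
  "indices p = enat ` {..<p} \<union> {\<infinity>}"

definition h_elt :: "nat \<Rightarrow> enat \<Rightarrow> xy word set" where
  "h_elt p i =
     (case i of enat j \<Rightarrow> x2y p \<otimes>\<^bsub>grp p\<^esub> xy2 p [^]\<^bsub>grp p\<^esub> j | \<infinity> \<Rightarrow> xy2 p)"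

definition H_cyc :: "nat \<Rightarrow> enat \<Rightarrow> xy word set set" where
  "H_cyc p i = generate (grp p) {h_elt p i}"

definition g_elt :: "nat \<Rightarrow> nat \<Rightarrow> nat \<Rightarrow> xy word set" where
  "g_elt p k l =
     x2y p [^]\<^bsub>grp p\<^esub> (- int k) \<otimes>\<^bsub>grp p\<^esub> xy2 p [^]\<^bsub>grp p\<^esub> (- int l) \<otimes>\<^bsub>grp p\<^esub> gx p
       \<otimes>\<^bsub>grp p\<^esub> x2y p [^]\<^bsub>grp p\<^esub> k \<otimes>\<^bsub>grp p\<^esub> xy2 p [^]\<^bsub>grp p\<^esub> l"

definition G_cyc :: "nat \<Rightarrow> nat \<Rightarrow> nat \<Rightarrow> xy word set set" where
  "G_cyc p k l = generate (grp p) {g_elt p k l}"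

definition cube_roots :: "nat \<Rightarrow> nat set" where
  "cube_roots p = {i. 1 < i \<and> i < p \<and> [i ^ 3 = 1] (mod p)}"

definition K_sub :: "nat \<Rightarrow> nat \<Rightarrow> nat \<Rightarrow> xy word set set" where
  "K_sub p i l = subgroup_join (grp p) (H_cyc p (enat i)) (G_cyc p 0 l)"

definition H_cycs :: "nat \<Rightarrow> xy word set set set" where
  "H_cycs p = {H_cyc p i | i. i \<in> indices p}"

definition G_cycs :: "nat \<Rightarrow> xy word set set set" where
  "G_cycs p = {G_cyc p k l | k l. k < p \<and> l < p}"

definition standard_subgroups :: "nat \<Rightarrow> xy word set set set" where
  "standard_subgroups p =
     {{\<one>\<^bsub>grp p\<^esub>}, carrier (grp p), H_sub p} \<union> H_cycs p \<union> G_cycs p"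

definition K_subs :: "nat \<Rightarrow> xy word set set set" where
  "K_subs p = {K_sub p i l | i l. i \<in> cube_roots p \<and> l < p}"

end

theory Submission
  imports
    Defs
    "HOL-Algebra.Zassenhaus"
    "HOL-Number_Theory.Residue_Primitive_Roots"
begin

text \<open>
  Put \<open>a = x\<inverse>y = x\<^sup>2y\<close> and \<open>b = xy\<inverse> = xy\<^sup>2\<close>.  The relator \<open>(xy)\<^sup>3\<close> says exactly that \<open>a\<close> and \<open>b\<close>
  commute, and conjugation by \<open>x\<close> permutes \<open>a\<close>, \<open>b\<inverse>\<close>, \<open>a\<inverse>b\<close> cyclically.  So every element has the
  form \<open>x\<^sup>i a\<^sup>k b\<^sup>l\<close>, and a model on triples of residues shows that these \<open>3n\<^sup>2\<close> elements are distinct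
  (\<open>triangle_group_grp\<close>).  Geometrically, \<open>(3,3|3,n)\<close> acts from the right on the plane of pairs of
  residues modulo \<open>n\<close>: \<open>a\<^sup>k b\<^sup>l\<close> is the translation by \<open>(k, l)\<close>, and \<open>x\<close> is the rotation
  \<open>R (u, v) = (- u - v, u)\<close>, for which \<open>1 + R + R\<^sup>2 = 0\<close>.  In this picture \<open>H\<close> is the group of all
  translations, \<open>H(i)\<close> consists of the translations in direction \<open>(1, i)\<close> (or \<open>(0, 1)\<close> for
  \<open>i = \<infinity>\<close>), and \<open>G(k,l)\<close> is the group of rotations about the point \<open>(k, l)\<close>.

  Let \<open>n = p > 3\<close> be prime.  Then \<open>1 - R\<close> has the invertible determinant \<open>3\<close>, so that every element
  outside \<open>H\<close> is a rotation about some point or the inverse of one (\<open>rot_eq_pt_rot\<close>).  A subgroup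
  \<open>A\<close> that contains a rotation is determined by this rotation and by \<open>A \<inter> H\<close>
  (\<open>subgroup_subset_of_common_rotation\<close>), and \<open>A \<inter> H\<close> is an \<open>R\<close>-invariant subspace of the plane over
  the field with \<open>p\<close> elements.  If it is zero, then \<open>A\<close> is some \<open>G(k,l)\<close>; if it is everything, then
  \<open>A = G\<close>.  The determinant of \<open>(k, l)\<close> and its image under rotation is \<open>k\<^sup>2 + kl + l\<^sup>2\<close> up to sign, so
  the invariant lines are those of a slope \<open>i\<close> with \<open>1 + i + i\<^sup>2 = 0\<close>, that is, of a slope \<open>i \<noteq> 1\<close> with
  \<open>i\<^sup>3 = 1\<close>.  There are two such slopes if \<open>3\<close> divides \<open>p - 1\<close>, and none otherwise.  If
  \<open>A \<inter> H\<close> is such a line, then \<open>A\<close> is the stabilizer of a line of slope \<open>i\<close> in the plane, and \<open>K(i,l)\<close> is the one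
  that belongs to the line through \<open>(0, l)\<close> (\<open>subgroup_cases\<close>).

  All statements about joins are now statements about points and lines: \<open>H(i)\<close> and \<open>G(k,l)\<close>
  generate the stabilizer of the line of slope \<open>i\<close> through \<open>(k, l)\<close> if \<open>i\<close> is an invariant slope, and
  everything otherwise; two rotations about different points generate the stabilizer of the line
  through these points if the slope of that line is invariant, and everything otherwise.

  For \<open>n = 2\<close> and \<open>n = 3\<close> the point is that a homomorphism on \<open>(3,3|3,n)\<close> whose image is not
  commutative is injective (\<open>inj_on_hom_if_noncommuting\<close>).  So any two non-commuting elements of a
  group of order \<open>3n\<^sup>2\<close> that satisfy the relations give an isomorphism.
\<close>

section \<open>Commuting translations rotated by an element of order three\<close>

text \<open>
  Conjugation is a homomorphism; stated without inverses so that it can move \<open>x\<close> past powers.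
\<close>

lemma (in group) intertwine_int_pow:
  assumes [simp]: "x \<in> carrier G" "u \<in> carrier G" "v \<in> carrier G" and "x \<otimes> u = v \<otimes> x"
  shows "x \<otimes> u [^] (k::int) = v [^] k \<otimes> x"
proof -
  have conj: "v = x \<otimes> u \<otimes> inv x"
    using assms(4) by (simp add: m_assoc)
  have nat_pow: "x \<otimes> w [^] m = (x \<otimes> w \<otimes> inv x) [^] m \<otimes> x"
    if [simp]: "w \<in> carrier G" for w and m :: nat
  proof (induction m)
    case (Suc m)
    have "x \<otimes> w [^] Suc m = (x \<otimes> w [^] m) \<otimes> w"
      by (simp add: m_assoc)
    also have "\<dots> = (x \<otimes> w \<otimes> inv x) [^] m \<otimes> (x \<otimes> w \<otimes> inv x) \<otimes> x"
      unfolding Suc by (simp add: m_assoc)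
    finally show ?case by simp
  qed simp
  have inv_conj: "inv v = x \<otimes> inv u \<otimes> inv x"
    by (simp add: conj inv_mult_group m_assoc)
  show ?thesis
  proof (cases k rule: int_cases2)
    case (nonneg m)
    then show ?thesis using nat_pow[of u m] by (simp add: conj int_pow_int)
  next
    case (nonpos m)
    then show ?thesis
      using nat_pow[of "inv u" m] unfolding inv_conj[symmetric]
      by (simp add: int_pow_neg_int nat_pow_inv)
  qed
qed

text \<open>
  The elements \<open>a\<close> and \<open>b\<close> stand for \<open>x\<inverse>y\<close> and \<open>xy\<inverse>\<close>.  Conjugation by \<open>x\<close> acts linearly on the
  exponents of \<open>a\<^sup>k b\<^sup>l\<close>.
\<close>

locale triangle_relations = group G for G (structure) +
  fixes n :: nat and x a b
  assumes x_closed [simp]: "x \<in> carrier G"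
    and a_closed [simp]: "a \<in> carrier G"
    and b_closed [simp]: "b \<in> carrier G"
    and x_cubed: "x \<otimes> x \<otimes> x = \<one>"
    and a_b_commute: "a \<otimes> b = b \<otimes> a"
    and x_a: "x \<otimes> a = inv b \<otimes> x"
    and x_b: "x \<otimes> b = a \<otimes> inv b \<otimes> x"
    and a_pow_n: "a [^] n = \<one>"
begin

definition tr :: "int \<Rightarrow> int \<Rightarrow> 'a" where
  "tr k l = a [^] k \<otimes> b [^] l"

lemma tr_closed [simp]: "tr k l \<in> carrier G"
  by (simp add: tr_def)

lemma tr_0 [simp]: "tr 0 0 = \<one>"
  by (simp add: tr_def)

lemma tr_1_0: "tr 1 0 = a" and tr_0_1: "tr 0 1 = b"
  by (simp_all add: tr_def)

lemma tr_mult [simp]: "tr k l \<otimes> tr k' l' = tr (k + k') (l + l')"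
proof -
  have "a \<otimes> b [^] l = b [^] l \<otimes> a"
    by (rule intertwine_int_pow) (simp_all add: a_b_commute)
  then have "b [^] l \<otimes> a [^] k' = a [^] k' \<otimes> b [^] l"
    by (intro intertwine_int_pow) simp_all
  then have "a [^] k \<otimes> (b [^] l \<otimes> a [^] k') \<otimes> b [^] l' = a [^] k \<otimes> (a [^] k' \<otimes> b [^] l) \<otimes> b [^] l'"
    by simp
  then show ?thesis
    by (simp add: tr_def int_pow_mult m_assoc)
qed

lemma tr_mult_assoc [simp]: "g \<in> carrier G \<Longrightarrow> tr k l \<otimes> (tr k' l' \<otimes> g) = tr (k + k') (l + l') \<otimes> g"
  by (simp flip: m_assoc)

lemma inv_tr [simp]: "inv tr k l = tr (- k) (- l)"
  by (rule inv_equality) simp_all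

lemma tr_nat_pow: "tr k l [^] (m::nat) = tr (int m * k) (int m * l)"
  by (induction m) (simp_all add: algebra_simps)

lemma tr_pow: "tr k l [^] (m::int) = tr (m * k) (m * l)"
  by (cases m rule: int_cases2) (simp_all add: int_pow_neg_int int_pow_int tr_nat_pow)

text \<open>
  In terms of the exponents, conjugation by \<open>x\<close> is the inverse \<open>R\<inverse> (k, l) = (l, - k - l)\<close> of the
  rotation \<open>R (k, l) = (- k - l, k)\<close>.
\<close>

lemma x_tr: "x \<otimes> tr k l = tr l (- k - l) \<otimes> x"
proof -
  have inv_b: "inv b = tr 0 (- 1)"
    using inv_tr[of 0 1] by (simp add: tr_0_1)
  have "x \<otimes> a = tr 0 (- 1) \<otimes> x"
    using x_a by (simp add: inv_b)
  then have 1: "x \<otimes> a [^] k = tr 0 (- 1) [^] k \<otimes> x"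
    by (intro intertwine_int_pow) simp_all
  have "a \<otimes> inv b = tr 1 (- 1)"
    using tr_mult[of 1 0 0 "- 1"] by (simp add: inv_b tr_1_0)
  then have "x \<otimes> b = tr 1 (- 1) \<otimes> x"
    using x_b by simp
  then have 2: "x \<otimes> b [^] l = tr 1 (- 1) [^] l \<otimes> x"
    by (intro intertwine_int_pow) simp_all
  have "x \<otimes> tr k l = (x \<otimes> a [^] k) \<otimes> b [^] l"
    by (simp add: tr_def m_assoc)
  also have "\<dots> = tr 0 (- k) \<otimes> (x \<otimes> b [^] l)"
    unfolding 1 by (simp add: tr_pow m_assoc)
  also have "\<dots> = tr l (- k - l) \<otimes> x"
    unfolding 2 by (simp add: tr_pow)
  finally show ?thesis .
qed

lemma tr_x: "tr k l \<otimes> x = x \<otimes> tr (- k - l) k"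
  by (simp add: x_tr)

lemma tr_x_assoc: "g \<in> carrier G \<Longrightarrow> tr k l \<otimes> (x \<otimes> g) = x \<otimes> (tr (- k - l) k \<otimes> g)"
  using tr_x[of k l] by (metis m_assoc tr_closed x_closed)

lemma x_x_x: "g \<in> carrier G \<Longrightarrow> x \<otimes> (x \<otimes> (x \<otimes> g)) = g"
  using x_cubed by (metis l_one m_assoc m_closed x_closed)

lemma inv_x: "inv x = x \<otimes> x"
  by (rule inv_equality) (simp_all add: x_cubed)

text \<open>
  The order of \<open>b\<close> divides \<open>n\<close> because \<open>b\<inverse>\<close> is conjugate to \<open>a\<close>.
\<close>

lemma tr_n: "tr (int n) 0 = \<one>" "tr 0 (int n) = \<one>"
proof -
  show 1: "tr (int n) 0 = \<one>"
    using a_pow_n by (simp add: tr_def int_pow_int)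
  have "x \<otimes> tr (int n) 0 = tr 0 (- int n) \<otimes> x"
    by (simp add: x_tr)
  then have "tr 0 (- int n) = \<one>"
    unfolding 1 using r_cancel_one'[of x "tr 0 (- int n)"] by simp
  then have "inv (tr 0 (- int n)) = \<one>" by simp
  then show "tr 0 (int n) = \<one>" by simp
qed

lemma tr_cong:
  assumes "[k = k'] (mod int n)" "[l = l'] (mod int n)"
  shows "tr k l = tr k' l'"
proof -
  obtain c d where c: "k' = k + int n * c" and d: "l' = l + int n * d"
    using assms by (auto simp: cong_iff_lin)
  have "tr k' l' = tr k l \<otimes> (tr (int n) 0 [^] c \<otimes> tr 0 (int n) [^] d)"
    by (simp add: c d tr_pow mult.commute)
  then show ?thesis by (simp add: tr_n)
qed

text \<open>
  Elements act from the right on pairs, so \<open>rot s t\<close> is the affine map that first applies the rotation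
  \<open>R\<close> and then translates by \<open>(s, t)\<close>.
\<close>

definition rot :: "int \<Rightarrow> int \<Rightarrow> 'a" where
  "rot s t = x \<otimes> tr s t"

lemma rot_closed [simp]: "rot s t \<in> carrier G"
  by (simp add: rot_def)

lemma rot_mult_tr [simp]: "rot s t \<otimes> tr k l = rot (s + k) (t + l)"
  by (simp add: rot_def m_assoc)

lemma tr_mult_rot [simp]: "tr k l \<otimes> rot s t = rot (s - k - l) (t + k)"
  by (simp add: rot_def tr_x_assoc algebra_simps)

text \<open>
  This holds because \<open>1 + R + R\<^sup>2 = 0\<close>: the translation parts of the three factors cancel.
\<close>

lemma rot_cubed: "rot s t \<otimes> (rot s t \<otimes> rot s t) = \<one>"
  using x_cubed by (simp add: rot_def m_assoc tr_x_assoc x_x_x)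

lemma inv_rot: "inv rot s t = rot s t \<otimes> rot s t"
  by (rule inv_equality) (simp_all add: rot_cubed m_assoc)

lemma inv_rot_mult_rot [simp]: "inv rot s t \<otimes> rot s' t' = tr (s' - s) (t' - t)"
  using inv_solve_left[of "tr (s' - s) (t' - t)" "rot s t" "rot s' t'"] by simp

lemma rot_mult_inv_rot: "rot s t \<otimes> inv rot s' t' = tr (t - t') (s' - s - t + t')"
  using inv_solve_right[of "tr (t - t') (s' - s - t + t')" "rot s t" "rot s' t'"] by simp

lemma tr_mult_inv_rot: "tr k l \<otimes> inv rot s t = inv rot (s - k) (t - l)"
proof -
  have "inv (rot s t \<otimes> tr (- k) (- l)) = inv (tr (- k) (- l)) \<otimes> inv rot s t"
    by (rule inv_mult_group) simp_all
  then show ?thesis by simp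
qed

lemma inv_rot_mult_tr: "inv rot s t \<otimes> tr k l = inv rot (s + k + l) (t - k)"
proof -
  have "inv (tr (- k) (- l) \<otimes> rot s t) = inv rot s t \<otimes> inv (tr (- k) (- l))"
    by (rule inv_mult_group) simp_all
  then show ?thesis by simp
qed

lemma conj_tr_by_rot: "rot s t \<otimes> tr k l \<otimes> inv rot s t = tr l (- k - l)"
  by (simp add: rot_mult_inv_rot)

lemma conj_tr_by_inv_rot: "inv rot s t \<otimes> tr k l \<otimes> rot s t = tr (- k - l) k"
  by (simp add: m_assoc)

end

section \<open>The semidirect product of order three times a square\<close>

text \<open>
  The last two assumptions say that nothing collapses: \<open>a\<close> and \<open>b\<close> span a group isomorphic to the
  plane of pairs of residues modulo \<open>n\<close>, and \<open>x\<close> lies outside it.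
\<close>

locale triangle_group = triangle_relations +
  assumes n_gt_1: "1 < n"
    and generated: "generate G {x, a} = carrier G"
    and tr_free: "tr k l = \<one> \<Longrightarrow> int n dvd k \<and> int n dvd l"
    and x_not_tr: "x \<noteq> tr k l"
begin

lemma tr_eq_one_iff: "tr k l = \<one> \<longleftrightarrow> int n dvd k \<and> int n dvd l"
  using tr_free[of k l] tr_cong[of k 0 l 0] by (auto simp: cong_0_iff)

lemma tr_eq_iff: "tr k l = tr k' l' \<longleftrightarrow> [k = k'] (mod int n) \<and> [l = l'] (mod int n)"
proof
  assume "tr k l = tr k' l'"
  then have "tr k l \<otimes> inv tr k' l' = \<one>"
    by (simp del: inv_tr tr_mult)
  then have "tr (k - k') (l - l') = \<one>"
    by simp
  then show "[k = k'] (mod int n) \<and> [l = l'] (mod int n)"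
    using tr_free by (auto simp: cong_iff_dvd_diff)
qed (auto intro: tr_cong)

lemma rot_eq_iff: "rot s t = rot s' t' \<longleftrightarrow> [s = s'] (mod int n) \<and> [t = t'] (mod int n)"
  by (simp add: rot_def tr_eq_iff)

lemma rot_neq_tr: "rot s t \<noteq> tr k l"
proof
  assume "rot s t = tr k l"
  then have "rot s t \<otimes> tr (- s) (- t) = tr k l \<otimes> tr (- s) (- t)"
    by simp
  then have "x = tr (k - s) (l - t)"
    by (simp add: rot_def m_assoc)
  then show False
    using x_not_tr by blast
qed

lemma inv_rot_neq_tr: "inv rot s t \<noteq> tr k l"
  using rot_neq_tr[of s t "- k" "- l"] inv_inv[of "rot s t"] by (metis inv_tr rot_closed)

text \<open>
  Otherwise \<open>x\<^sup>2\<close>, hence also \<open>x = x\<^sup>4\<close>, would be a translation.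
\<close>

lemma rot_neq_inv_rot: "rot s t \<noteq> inv rot s' t'"
proof
  assume "rot s t = inv rot s' t'"
  then have "inv rot s' t' \<otimes> rot s t = inv rot s' t' \<otimes> (rot s' t' \<otimes> rot s' t')"
    using inv_rot by simp
  also have "\<dots> = rot s' t'"
    by (simp flip: m_assoc)
  finally show False
    using rot_neq_tr[of s' t'] by (metis inv_rot_mult_rot)
qed

lemma rot_mult_rot: "rot s t \<otimes> rot s' t' = inv rot (s' - t + t') (s - s' + t)"
proof -
  have "rot s t \<otimes> (rot s t \<otimes> tr (s' - s) (t' - t)) = inv rot s t \<otimes> tr (s' - s) (t' - t)"
    by (simp add: inv_rot del: rot_mult_tr flip: m_assoc)
  then show ?thesis
    by (simp add: inv_rot_mult_tr algebra_simps)
qed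

lemma inv_rot_mult_inv_rot: "inv rot s t \<otimes> inv rot s' t' = rot (s - t' + t) (s' - s + t')"
proof -
  have "inv (rot s' t' \<otimes> rot s t) = inv rot s t \<otimes> inv rot s' t'"
    by (rule inv_mult_group) simp_all
  then show ?thesis
    by (simp add: rot_mult_rot)
qed

text \<open>
  The three kinds of elements are the three cosets of the translations.  The coset of \<open>x\<^sup>2\<close> is described
  by inverses of rotations, because a subgroup that meets it then visibly contains a rotation.
\<close>

lemma elementE:
  assumes "g \<in> carrier G"
  obtains (translation) k l where "g = tr k l"
    | (rotation) s t where "g = rot s t"
    | (inverse_rotation) s t where "g = inv rot s t"
proof -
  let ?S = "{g. \<exists>k l. g = tr k l \<or> g = rot k l \<or> g = inv rot k l}"
  have S: "tr k l \<in> ?S" "rot k l \<in> ?S" "inv rot k l \<in> ?S" for k l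
    by blast+
  have S_cases: "P g" if "g \<in> ?S" "\<And>k l. P (tr k l)" "\<And>k l. P (rot k l)" "\<And>k l. P (inv rot k l)"
    for P g
    using that by blast
  note products = tr_mult_inv_rot inv_rot_mult_tr rot_mult_rot rot_mult_inv_rot inv_rot_mult_inv_rot
  have "subgroup ?S G"
  proof (rule subgroupI)
    show "inv g \<in> ?S" if "g \<in> ?S" for g
      by (rule S_cases[OF that, where P = "\<lambda>g. inv g \<in> ?S"]) (simp_all add: S del: mem_Collect_eq)
    show "g \<otimes> h \<in> ?S" if g: "g \<in> ?S" and h: "h \<in> ?S" for g h
      by (rule S_cases[OF g, where P = "\<lambda>g. g \<otimes> h \<in> ?S"];
          rule S_cases[OF h, where P = "\<lambda>h. _ \<otimes> h \<in> ?S"];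
          simp add: products S del: mem_Collect_eq)
  qed auto
  moreover have "x \<in> ?S" "a \<in> ?S"
    using S(2)[of 0 0] S(1)[of 1 0] by (simp_all add: rot_def tr_1_0 del: mem_Collect_eq)
  ultimately have "generate G {x, a} \<subseteq> ?S"
    by (intro generate_subgroup_incl) auto
  then show thesis
    using assms that unfolding generated by blast
qed

definition translation_group :: "'a set" where
  "translation_group = {tr k l | k l. True}"

lemma tr_in_translations [simp]: "tr k l \<in> translation_group"
  by (auto simp: translation_group_def)

lemma rot_notin_translations [simp]: "rot s t \<notin> translation_group"
  using rot_neq_tr by (auto simp: translation_group_def)

lemma inv_rot_notin_translations [simp]: "inv rot s t \<notin> translation_group"
  using inv_rot_neq_tr by (auto simp: translation_group_def)

lemma subgroup_translations: "subgroup translation_group G"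
  by (rule subgroupI) (auto simp: translation_group_def, blast+)

lemma card_translations: "card translation_group = n * n"
proof -
  let ?R = "{0..<int n}"
  have "tr k l = tr (k mod int n) (l mod int n)" for k l
    by (rule tr_cong) (simp_all add: cong_def)
  moreover have "k mod int n \<in> ?R" for k
    using n_gt_1 by simp
  ultimately have "translation_group = (\<lambda>(k, l). tr k l) ` (?R \<times> ?R)"
    by (fastforce simp: translation_group_def image_iff)
  moreover have "inj_on (\<lambda>(k, l). tr k l) (?R \<times> ?R)"
    by (auto simp: inj_on_def tr_eq_iff cong_def)
  ultimately show ?thesis
    by (simp add: card_image card_cartesian_product)
qed

lemma finite_translations: "finite translation_group"
  using card_translations n_gt_1 by (intro card_ge_0_finite) simp

lemma order_G: "order G = 3 * n * n"
proof -
  let ?R = "(\<otimes>) x ` translation_group"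
  have carrier: "carrier G = translation_group \<union> (?R \<union> m_inv G ` ?R)" (is "_ = ?U")
  proof
    show "carrier G \<subseteq> ?U"
      by (rule subsetI, erule elementE) (auto simp: rot_def)
  qed (auto simp: translation_group_def)
  have R: "?R = {rot s t | s t. True}" "m_inv G ` ?R = {inv rot s t | s t. True}"
    by (auto simp: translation_group_def rot_def)
  have "g \<notin> ?R \<union> m_inv G ` ?R" if "g \<in> translation_group" for g
    unfolding R(2) unfolding R(1) using that by auto
  moreover have "g \<notin> m_inv G ` ?R" if "g \<in> ?R" for g
    using that unfolding R(2) unfolding R(1) by (auto simp: rot_neq_inv_rot)
  ultimately have disj: "translation_group \<inter> (?R \<union> m_inv G ` ?R) = {}" "?R \<inter> m_inv G ` ?R = {}"
    by blast+
  have "card ?R = card translation_group"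
    by (rule card_image) (auto simp: inj_on_def translation_group_def)
  moreover have "card (m_inv G ` ?R) = card ?R"
    by (rule card_image, rule inj_on_subset[OF inv_inj]) (auto simp: translation_group_def)
  ultimately show ?thesis
    unfolding order_def carrier
    by (simp add: card_Un_disjoint disj finite_translations card_translations)
qed

text \<open>
  Two translation vectors whose determinant is a unit form a basis of the plane.
\<close>

lemma translations_subset_of_basis:
  assumes A: "subgroup A G" and "tr k l \<in> A" and "tr k' l' \<in> A"
    and "coprime (k * l' - l * k') (int n)"
  shows "translation_group \<subseteq> A"
proof
  define D where "D = k * l' - l * k'"
  obtain e where e: "[D * e = 1] (mod int n)"
    using cong_solve_coprime_int assms(4) unfolding D_def by blast
  fix g assume "g \<in> translation_group"
  then obtain u v where g: "g = tr u v"
    by (auto simp: translation_group_def)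
  have lin: "tr (m * k + m' * k') (m * l + m' * l') \<in> A" for m m'
    using subgroup.m_closed[OF A subgroup_int_pow_closed[OF A assms(2), of m]
        subgroup_int_pow_closed[OF A assms(3), of m']]
    by (simp add: tr_pow)
  (* Cramer's rule: D (u, v) is this combination of (k, l) and (k', l'), and e inverts D. *)
  have "tr (D * e * u) (D * e * v) \<in> A"
    using lin[of "e * (u * l' - v * k')" "e * (v * k - u * l)"]
    by (simp add: D_def algebra_simps)
  moreover have "tr (D * e * u) (D * e * v) = tr u v"
    by (rule tr_cong) (use cong_scalar_right[OF e] in \<open>fastforce\<close>)+
  ultimately show "g \<in> A"
    by (simp add: g)
qed

lemma rotate_translation:
  assumes "subgroup A G" "rot s t \<in> A" "tr k l \<in> A"
  shows "tr l (- k - l) \<in> A"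
  using assms subgroup.m_closed[OF assms(1)] subgroup.m_inv_closed[OF assms(1)]
  by (metis conj_tr_by_rot)

text \<open>
  Together with a rotation, a subgroup contains with the vector \<open>(k, l)\<close> also \<open>(l, - k - l)\<close>.  The
  determinant of the two is \<open>- (k\<^sup>2 + kl + l\<^sup>2)\<close>.
\<close>

lemma translations_subset_of_orbit:
  assumes "subgroup A G" "rot s t \<in> A" "tr k l \<in> A"
    and "coprime (k ^ 2 + k * l + l ^ 2) (int n)"
  shows "translation_group \<subseteq> A"
proof (rule translations_subset_of_basis[OF assms(1,3) rotate_translation[OF assms(1-3)]])
  have "k * (- k - l) - l * l = - (k ^ 2 + k * l + l ^ 2)"
    by (simp add: power2_eq_square algebra_simps)
  then show "coprime (k * (- k - l) - l * l) (int n)"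
    using assms(4) by (simp only: coprime_minus_left_iff)
qed

text \<open>
  Each element of \<open>A\<close> differs from one of \<open>1\<close>, \<open>r\<close>, \<open>r\<inverse>\<close> by a translation in \<open>A\<close>, where \<open>r\<close> is the
  common rotation.
\<close>

lemma subgroup_subset_of_common_rotation:
  assumes A: "subgroup A G" and B: "subgroup B G"
    and rot: "rot s t \<in> A" "rot s t \<in> B" and "A \<inter> translation_group \<subseteq> B"
  shows "A \<subseteq> B"
proof
  have via: "g \<in> B" if "g \<in> A" "h \<in> A" "h \<in> B" "inv h \<otimes> g \<in> translation_group" for g h
  proof -
    have [simp]: "g \<in> carrier G" "h \<in> carrier G"
      using that subgroup.mem_carrier[OF A] by auto
    have "inv h \<otimes> g \<in> B"
      using that assms(5) A by (auto intro: subgroup.m_closed subgroup.m_inv_closed)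
    then have "h \<otimes> (inv h \<otimes> g) \<in> B"
      using B that by (auto intro: subgroup.m_closed)
    then show ?thesis
      by (simp flip: m_assoc)
  qed
  fix g assume g: "g \<in> A"
  then have "g \<in> carrier G"
    using subgroup.mem_carrier[OF A] by auto
  then show "g \<in> B"
  proof (cases g rule: elementE)
    case (translation k l)
    then show ?thesis using g assms(5) by auto
  next
    case (rotation s' t')
    then show ?thesis using via[OF g rot] by simp
  next
    case (inverse_rotation s' t')
    have "g = inv rot s t \<otimes> tr (t - t') (s' - s - t + t') "
      by (simp add: inverse_rotation inv_rot_mult_tr)
    then have "inv (inv rot s t) \<otimes> g \<in> translation_group"
      by (simp flip: m_assoc)
    then show ?thesis
      using via[OF g, of "inv rot s t"] rot A B by (auto intro: subgroup.m_inv_closed)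
  qed
qed

lemma subgroup_eq_carrier:
  assumes "subgroup A G" "rot s t \<in> A" "translation_group \<subseteq> A"
  shows "A = carrier G"
proof
  show "carrier G \<subseteq> A"
    by (rule subgroup_subset_of_common_rotation[OF subgroup_self assms(1) rot_closed assms(2)])
      (use assms(3) in blast)
qed (use assms(1) subgroup.subset in blast)

lemma not_commutative: "x \<otimes> a \<noteq> a \<otimes> x"
proof
  assume "x \<otimes> a = a \<otimes> x"
  moreover have "x \<otimes> a = rot 1 0" "a \<otimes> x = rot (- 1) 1"
    using tr_mult_rot[of 1 0 0 0] by (simp_all add: rot_def tr_1_0)
  ultimately have "int n dvd 1"
    by (simp add: rot_eq_iff cong_iff_dvd_diff)
  then show False
    using n_gt_1 by simp
qed

text \<open>
  A rotation in the kernel would identify \<open>x\<close> with a translation, and translations commute with \<open>a\<close>.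
  A translation \<open>(k, l)\<close> in the kernel brings its rotated image along.  If the two span the plane, then
  \<open>a\<close> lies in the kernel.  Otherwise the prime \<open>n\<close> divides \<open>k\<^sup>2 + kl + l\<^sup>2\<close>; for \<open>n = 2\<close> this
  forces \<open>(k, l) = 0\<close>, and for \<open>n = 3\<close> it forces \<open>k = l\<close>.  But \<open>ab\<close> in the kernel is impossible, too,
  because then \<open>x\<close> conjugates \<open>a\<close> to \<open>b\<inverse>\<close>, which has the same image as \<open>a\<close>.
\<close>

lemma inj_on_hom_if_noncommuting:
  assumes n: "n = 2 \<or> n = 3" and K: "group K" and \<phi>: "\<phi> \<in> hom G K"
    and noncomm: "\<phi> x \<otimes>\<^bsub>K\<^esub> \<phi> a \<noteq> \<phi> a \<otimes>\<^bsub>K\<^esub> \<phi> x"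
  shows "inj_on \<phi> (carrier G)"
proof -
  interpret \<phi>: group_hom G K \<phi>
    using K \<phi> by (simp add: group_hom_def group_hom_axioms_def is_group)
  let ?ker = "kernel G K \<phi>"
  have ker: "subgroup ?ker G"
    by (rule \<phi>.subgroup_kernel)
  have tr_commute: "\<phi> (tr k l) \<otimes>\<^bsub>K\<^esub> \<phi> a = \<phi> a \<otimes>\<^bsub>K\<^esub> \<phi> (tr k l)" for k l
  proof -
    have "tr k l \<otimes> a = a \<otimes> tr k l"
      using tr_mult[of k l 1 0] tr_mult[of 1 0 k l] by (simp add: tr_1_0 add.commute)
    then show ?thesis
      by (metis \<phi>.hom_mult a_closed tr_closed)
  qed
  have rot_notin: "rot s t \<notin> ?ker" for s t
  proof
    assume "rot s t \<in> ?ker"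
    moreover have "rot s t \<otimes> tr (- s) (- t) = x"
      by (simp add: rot_def m_assoc)
    ultimately have "\<phi> x = \<phi> (tr (- s) (- t))"
      using \<phi>.hom_mult[of "rot s t" "tr (- s) (- t)"] by (simp add: kernel_def del: rot_mult_tr)
    then show False
      using noncomm tr_commute by simp
  qed
  have tr_1_1_notin: "tr 1 1 \<notin> ?ker"
  proof
    assume "tr 1 1 \<in> ?ker"
    then have "\<phi> a = \<phi> (tr 0 (- 1))"
      using \<phi>.hom_mult[of "tr 1 1" "tr 0 (- 1)"] by (simp add: kernel_def tr_1_0)
    moreover have "x \<otimes> tr 1 0 = tr 0 (- 1) \<otimes> x"
      by (simp add: x_tr)
    then have "x \<otimes> a = tr 0 (- 1) \<otimes> x"
      by (simp add: tr_1_0)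
    then have "\<phi> x \<otimes>\<^bsub>K\<^esub> \<phi> a = \<phi> (tr 0 (- 1)) \<otimes>\<^bsub>K\<^esub> \<phi> x"
      by (metis \<phi>.hom_mult a_closed tr_closed x_closed)
    ultimately show False
      using noncomm by simp
  qed
  have not_all: "\<not> translation_group \<subseteq> ?ker"
    using tr_1_1_notin tr_in_translations by blast
  have tr_trivial: "tr k l = \<one>" if "tr k l \<in> ?ker" for k l
  proof (rule ccontr)
    assume "tr k l \<noteq> \<one>"
    then have nontriv: "\<not> (int n dvd k \<and> int n dvd l)"
      by (simp add: tr_eq_one_iff)
    have "\<phi> (tr l (- k - l)) \<otimes>\<^bsub>K\<^esub> \<phi> x = \<phi> x \<otimes>\<^bsub>K\<^esub> \<phi> (tr k l)"
      using x_tr[of k l] by (metis \<phi>.hom_mult tr_closed x_closed)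
    then have "tr l (- k - l) \<in> ?ker"
      using that by (simp add: kernel_def \<phi>.H.l_cancel_one')
    note basis = translations_subset_of_basis[OF ker that this]
    have not_coprime: "\<not> coprime (k * (- k - l) - l * l) (int n)"
      using basis not_all by blast
    consider "n = 2" | "n = 3"
      using n by blast
    then show False
    proof cases
      case 1
      then have "even k \<and> even l"
        using not_coprime by (auto simp: coprime_right_2_iff_odd)
      then show False
        using nontriv 1 by simp
    next
      case 2
      have "3 dvd k * (- k - l) - l * l"
        using not_coprime 2 prime_imp_coprime[of "3::int"] coprime_commute by fastforce
      also have "k * (- k - l) - l * l = 3 * (- k * l) - (k - l) * (k - l)"
        by (simp add: algebra_simps)
      finally have "3 dvd (k - l) * (k - l)"
        by (simp add: dvd_diff_right_iff)
      then have "3 dvd k - l"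
        using prime_dvd_mult_iff[of "3::int"] by auto
      then have "[k = l] (mod 3)"
        by (simp add: cong_iff_dvd_diff)
      then have "\<not> 3 dvd k"
        using nontriv 2 cong_dvd_iff by auto
      then have "k mod 3 = 1 \<or> k mod 3 = 2"
        by presburger
      then have "[k * k = 1] (mod 3)"
        by (auto simp: cong_def mod_mult_eq[of k 3 k, symmetric])
      moreover from \<open>[k = l] (mod 3)\<close> have "[k * k = k * l] (mod 3)"
        by (rule cong_scalar_left)
      ultimately have "[k * l = 1] (mod 3)"
        using cong_sym cong_trans by blast
      with \<open>[k * k = 1] (mod 3)\<close> have "tr k l [^] k = tr 1 1"
        using 2 by (simp add: tr_pow tr_cong)
      then show False
        using subgroup_int_pow_closed[OF ker that, of k] tr_1_1_notin by simp
    qed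
  qed
  have trivial: "g \<in> {\<one>}" if "g \<in> ?ker" for g
  proof -
    have "g \<in> carrier G"
      using that by (simp add: kernel_def)
    then show ?thesis
    proof (cases g rule: elementE)
      case (inverse_rotation s t)
      then show ?thesis
        using rot_notin subgroup.m_inv_closed[OF ker that] by simp
    qed (use that rot_notin tr_trivial in auto)
  qed
  have "?ker = {\<one>}"
    using trivial subgroup.one_closed[OF ker] by blast
  then show ?thesis
    using \<phi>.trivial_ker_imp_inj by blast
qed

end

section \<open>The presentation\<close>

text \<open>
  That \<open>x\<inverse>y\<close> and \<open>xy\<inverse>\<close> commute comes from \<open>y\<inverse>x\<inverse> = xyxy\<close>, which is the relator \<open>(xy)\<^sup>3\<close>.  The
  conjugation rules use only that \<open>x\<close> and \<open>y\<close> have order three.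
\<close>

lemma (in group) triangle_relations_of_presentation:
  assumes [simp]: "x \<in> carrier G" "y \<in> carrier G"
    and x3: "x [^] (3::nat) = \<one>" and y3: "y [^] (3::nat) = \<one>"
    and xy3: "(x \<otimes> y) [^] (3::nat) = \<one>" and "(inv x \<otimes> y) [^] n = \<one>"
  shows "triangle_relations G n x (inv x \<otimes> y) (x \<otimes> inv y)"
proof
  have inv_square: "inv g = g \<otimes> g" if "g \<in> carrier G" "g [^] (3::nat) = \<one>" for g
  proof -
    have "g \<otimes> g \<otimes> g = \<one>"
      using that by (simp add: numeral_3_eq_3)
    then show ?thesis
      using that(1) by (intro inv_equality) simp_all
  qed
  have inv_x: "inv x = x \<otimes> x" and inv_y: "inv y = y \<otimes> y"
    and "inv (x \<otimes> y) = (x \<otimes> y) \<otimes> (x \<otimes> y)"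
    using x3 y3 xy3 by (simp_all add: inv_square)
  then have cancel: "inv y \<otimes> inv x = x \<otimes> y \<otimes> x \<otimes> y"
    by (simp add: inv_mult_group m_assoc)
  show "x \<otimes> x \<otimes> x = \<one>"
    using x3 by (simp add: numeral_3_eq_3)
  have "x \<otimes> (x \<otimes> inv y) = inv x \<otimes> inv y"
    by (simp add: inv_x m_assoc)
  also have "\<dots> = inv x \<otimes> y \<otimes> inv (x \<otimes> inv y) \<otimes> x"
    by (simp add: inv_mult_group m_assoc) (simp add: inv_y m_assoc)
  finally show "x \<otimes> (x \<otimes> inv y) = inv x \<otimes> y \<otimes> inv (x \<otimes> inv y) \<otimes> x" .
  show "x \<otimes> (inv x \<otimes> y) = inv (x \<otimes> inv y) \<otimes> x"
    by (simp add: inv_mult_group m_assoc) (simp flip: m_assoc)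
  have "x \<otimes> inv y \<otimes> (inv x \<otimes> y) = x \<otimes> (inv y \<otimes> inv x) \<otimes> y"
    by (simp add: m_assoc)
  also have "\<dots> = (x \<otimes> x) \<otimes> y \<otimes> x \<otimes> (y \<otimes> y)"
    unfolding cancel by (simp add: m_assoc)
  also have "\<dots> = inv x \<otimes> y \<otimes> (x \<otimes> inv y)"
    unfolding inv_x[symmetric] inv_y[symmetric] by (simp add: m_assoc)
  finally show "inv x \<otimes> y \<otimes> (x \<otimes> inv y) = x \<otimes> inv y \<otimes> (inv x \<otimes> y)" ..
qed (use assms in simp_all)

lemma word_class_pow:
  "word_class R w [^]\<^bsub>presented_group R\<^esub> (m::nat) = word_class R (concat (replicate m w))"
proof (induction m)
  case (Suc m)
  have "concat (replicate m w) @ w = concat (replicate (Suc m) w)"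
    by (induction m) simp_all
  then show ?case
    by (simp add: Suc mult_presented_group)
qed (simp add: one_presented_group)

lemma word_class_relator: "r \<in> R \<Longrightarrow> word_class R r = \<one>\<^bsub>presented_group R\<^esub>"
  using word_eq.relator[of r R "[]" "[]"] by (simp add: one_presented_group word_class_eq_iff)

lemma generator_in_carrier: "generator R c \<in> carrier (presented_group R)"
  by (simp add: generator_def carrier_presented_group)

lemma inv_generator: "inv\<^bsub>presented_group R\<^esub> generator R c = word_class R [(c, False)]"
proof (rule group.inv_equality[OF group_presented_group])
  have "word_eq R ([] @ [(c, False), (c, \<not> False)] @ []) ([] @ [])"
    by (rule word_eq.cancel)
  then show "word_class R [(c, False)] \<otimes>\<^bsub>presented_group R\<^esub> generator R c = \<one>\<^bsub>presented_group R\<^esub>"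
    by (simp add: generator_def mult_presented_group one_presented_group word_class_eq_iff)
qed (simp_all add: generator_def carrier_presented_group)

lemma generate_generators: "generate (presented_group R) (range (generator R)) = carrier (presented_group R)"
proof
  interpret group "presented_group R" by (rule group_presented_group)
  let ?gen = "generate (presented_group R) (range (generator R))"
  show "?gen \<subseteq> carrier (presented_group R)"
    by (rule generate_incl) (auto simp: generator_in_carrier)
  have letter: "word_class R [(c, e)] \<in> ?gen" for c e
  proof (cases e)
    case True
    then show ?thesis
      using generate.incl[of "generator R c" "range (generator R)"] by (simp add: generator_def)
  next
    case False
    then show ?thesis
      using generate.inv[of "generator R c" "range (generator R)" "presented_group R"] by (simp add: inv_generator)
  qed
  have "word_class R w \<in> ?gen" for w
  proof (induction w)
    case Nil
    then show ?case
      using generate.one[of "presented_group R"] by (simp add: one_presented_group)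
  next
    case (Cons l w)
    then show ?case
      using generate.eng[OF letter[of "fst l" "snd l"] Cons] by (simp add: mult_presented_group)
  qed
  then show "carrier (presented_group R) \<subseteq> ?gen"
    by (auto simp: carrier_presented_group)
qed

lemma word_eval_replicate:
  assumes "group K" "\<And>c. f c \<in> carrier K"
  shows "word_eval K f (concat (replicate m w)) = word_eval K f w [^]\<^bsub>K\<^esub> m"
proof -
  interpret group K by fact
  have closed: "word_eval K f u \<in> carrier K" for u
    by (induction u) (auto simp: assms(2))
  have append: "word_eval K f (u @ v) = word_eval K f u \<otimes>\<^bsub>K\<^esub> word_eval K f v" for u v
    by (induction u) (auto simp: assms(2) closed m_assoc)
  show ?thesis
    by (induction m) (simp_all add: append closed flip: nat_pow_Suc2)
qed

lemma group_grp: "group (grp n)"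
  unfolding grp_def by (rule group_presented_group)

lemma gx_closed: "gx n \<in> carrier (grp n)" and gy_closed: "gy n \<in> carrier (grp n)"
  by (simp_all add: gx_def gy_def grp_def generator_in_carrier)

lemma grp_relations:
  "gx n [^]\<^bsub>grp n\<^esub> (3::nat) = \<one>\<^bsub>grp n\<^esub>"
  "gy n [^]\<^bsub>grp n\<^esub> (3::nat) = \<one>\<^bsub>grp n\<^esub>"
  "(gx n \<otimes>\<^bsub>grp n\<^esub> gy n) [^]\<^bsub>grp n\<^esub> (3::nat) = \<one>\<^bsub>grp n\<^esub>"
  "(inv\<^bsub>grp n\<^esub> gx n \<otimes>\<^bsub>grp n\<^esub> gy n) [^]\<^bsub>grp n\<^esub> n = \<one>\<^bsub>grp n\<^esub>"
proof -
  have rep: "concat (replicate 3 [l]) = replicate 3 l" for l :: "xy \<times> bool"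
    by (simp add: numeral_3_eq_3)
  show "gx n [^]\<^bsub>grp n\<^esub> (3::nat) = \<one>\<^bsub>grp n\<^esub>" "gy n [^]\<^bsub>grp n\<^esub> (3::nat) = \<one>\<^bsub>grp n\<^esub>"
    unfolding gx_def gy_def grp_def generator_def word_class_pow rep
    by (rule word_class_relator, simp add: relators_333_def)+
  show "(gx n \<otimes>\<^bsub>grp n\<^esub> gy n) [^]\<^bsub>grp n\<^esub> (3::nat) = \<one>\<^bsub>grp n\<^esub>"
    unfolding gx_def gy_def grp_def generator_def mult_presented_group word_class_pow
    by (rule word_class_relator) (simp add: relators_333_def)
  show "(inv\<^bsub>grp n\<^esub> gx n \<otimes>\<^bsub>grp n\<^esub> gy n) [^]\<^bsub>grp n\<^esub> n = \<one>\<^bsub>grp n\<^esub>"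
    unfolding gx_def gy_def grp_def inv_generator unfolding generator_def mult_presented_group word_class_pow
    by (rule word_class_relator) (simp add: relators_333_def)
qed

lemma grp_universal:
  assumes K: "group K" and u: "u \<in> carrier K" and v: "v \<in> carrier K"
    and "u [^]\<^bsub>K\<^esub> (3::nat) = \<one>\<^bsub>K\<^esub>" "v [^]\<^bsub>K\<^esub> (3::nat) = \<one>\<^bsub>K\<^esub>"
    and "(u \<otimes>\<^bsub>K\<^esub> v) [^]\<^bsub>K\<^esub> (3::nat) = \<one>\<^bsub>K\<^esub>" "(inv\<^bsub>K\<^esub> u \<otimes>\<^bsub>K\<^esub> v) [^]\<^bsub>K\<^esub> n = \<one>\<^bsub>K\<^esub>"
  obtains \<phi> where "\<phi> \<in> hom (grp n) K" "\<phi> (gx n) = u" "\<phi> (gy n) = v"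
proof -
  interpret K: group K by fact
  define f where "f c = (case c of X \<Rightarrow> u | Y \<Rightarrow> v)" for c
  have f: "f c \<in> carrier K" for c
    using u v by (simp add: f_def split: xy.split)
  have "concat (replicate 3 [l]) = replicate 3 l" for l :: "xy \<times> bool"
    by (simp add: numeral_3_eq_3)
  then have "word_eval K f (replicate 3 l) = word_eval K f [l] [^]\<^bsub>K\<^esub> (3::nat)" for l
    using word_eval_replicate[of K f 3 "[l]", OF K f] by simp
  then have "word_eval K f r = \<one>\<^bsub>K\<^esub>" if "r \<in> relators_333 n" for r
    using that u v assms(4-7)
    by (auto simp: relators_333_def word_eval_replicate[OF K f] f_def)
  then obtain \<phi> where "\<phi> \<in> hom (grp n) K" "\<forall>c. \<phi> (generator (relators_333 n) c) = f c"
    unfolding grp_def using presented_group_universal[where f = f, OF K f] by blast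
  then show thesis
    using that by (simp add: gx_def gy_def f_def)
qed

lemma x2y_eq: "x2y n = inv\<^bsub>grp n\<^esub> gx n \<otimes>\<^bsub>grp n\<^esub> gy n"
  and xy2_eq: "xy2 n = gx n \<otimes>\<^bsub>grp n\<^esub> inv\<^bsub>grp n\<^esub> gy n"
proof -
  interpret group "grp n" by (rule group_grp)
  have "inv\<^bsub>grp n\<^esub> g = g [^]\<^bsub>grp n\<^esub> (2::nat)" if "g \<in> carrier (grp n)" "g [^]\<^bsub>grp n\<^esub> (3::nat) = \<one>\<^bsub>grp n\<^esub>" for g
  proof -
    have "g [^]\<^bsub>grp n\<^esub> (2::nat) \<otimes>\<^bsub>grp n\<^esub> g = \<one>\<^bsub>grp n\<^esub>"
      using that by (simp add: numeral_3_eq_3 numeral_2_eq_2)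
    then show ?thesis
      using that(1) by (intro inv_equality) simp_all
  qed
  then show "x2y n = inv\<^bsub>grp n\<^esub> gx n \<otimes>\<^bsub>grp n\<^esub> gy n" "xy2 n = gx n \<otimes>\<^bsub>grp n\<^esub> inv\<^bsub>grp n\<^esub> gy n"
    by (simp_all add: x2y_def xy2_def grp_relations gx_closed gy_closed)
qed

lemma triangle_relations_grp: "triangle_relations (grp n) n (gx n) (x2y n) (xy2 n)"
  unfolding x2y_eq xy2_eq
  by (rule group.triangle_relations_of_presentation[OF group_grp gx_closed gy_closed grp_relations])

subsection \<open>A model on triples of residues\<close>

text \<open>
  The power \<open>R\<^sup>j\<close> of the rotation, for \<open>j\<close> in \<open>{0, 1, 2}\<close>.
\<close>

definition spin :: "int \<Rightarrow> int \<times> int \<Rightarrow> int \<times> int" where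
  "spin j = (\<lambda>(s, t). if j = 0 then (s, t) else if j = 1 then (- s - t, s) else (t, - s - t))"

text \<open>
  The triple \<open>(i, s, t)\<close> represents \<open>x\<^sup>i a\<^sup>s b\<^sup>t\<close>.  Moving \<open>x\<^sup>j\<close> to the left across \<open>a\<^sup>s b\<^sup>t\<close> turns the
  exponents into \<open>R\<^sup>j (s, t)\<close>.
\<close>

definition triangle_model :: "nat \<Rightarrow> (int \<times> int \<times> int) monoid" where
  "triangle_model n =
     \<lparr>carrier = {0..<3} \<times> {0..<int n} \<times> {0..<int n},
      mult = (\<lambda>(i, s) (j, u, v).
        ((i + j) mod 3, (fst (spin j s) + u) mod int n, (snd (spin j s) + v) mod int n)),
      one = (0, 0, 0)\<rparr>"

lemma triangle_model_mult:
  "(i, s, t) \<otimes>\<^bsub>triangle_model n\<^esub> (j, u, v) =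
    ((i + j) mod 3, (fst (spin j (s, t)) + u) mod int n, (snd (spin j (s, t)) + v) mod int n)"
  by (simp add: triangle_model_def)

lemma triangle_model_carrierE:
  assumes "g \<in> carrier (triangle_model n)"
  obtains i s t where "g = (i, s, t)" "i = 0 \<or> i = 1 \<or> i = 2"
    "0 \<le> s" "s < int n" "0 \<le> t" "t < int n"
proof -
  obtain i s t where g: "g = (i, s, t)"
    by (cases g)
  then have "0 \<le> i" "i < 3" "0 \<le> s" "s < int n" "0 \<le> t" "t < int n"
    using assms by (simp_all add: triangle_model_def)
  moreover from this have "i = 0 \<or> i = 1 \<or> i = 2"
    by arith
  ultimately show thesis
    using that g by blast
qed

text \<open>
  Adding a pair of residues to a rotated one produces sums of this shape.
\<close>

lemma mod_spin: "(- (d mod m) - e mod m + c) mod m = (- d - e + c) mod (m::int)"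
proof -
  have "- (d mod m) - e mod m + c = c - (d mod m + e mod m)"
    by simp
  also have "\<dots> mod m = (c - (d + e)) mod m"
    by (metis mod_add_eq mod_diff_right_eq)
  finally show ?thesis
    by (simp add: algebra_simps)
qed

lemma group_triangle_model:
  assumes "0 < n"
  shows "group (triangle_model n)"
proof (rule groupI)
  let ?M = "triangle_model n"
  show "g \<otimes>\<^bsub>?M\<^esub> h \<in> carrier ?M" if "g \<in> carrier ?M" "h \<in> carrier ?M" for g h
    using assms that by (auto simp: triangle_model_def split: prod.split)
  show "\<one>\<^bsub>?M\<^esub> \<in> carrier ?M"
    using assms by (simp add: triangle_model_def)
  show "g \<otimes>\<^bsub>?M\<^esub> h \<otimes>\<^bsub>?M\<^esub> k = g \<otimes>\<^bsub>?M\<^esub> (h \<otimes>\<^bsub>?M\<^esub> k)"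
    if g: "g \<in> carrier ?M" and h: "h \<in> carrier ?M" and k: "k \<in> carrier ?M" for g h k
  proof -
    obtain i s t where [simp]: "g = (i, s, t)"
      using g by (rule triangle_model_carrierE)
    obtain j u v where [simp]: "h = (j, u, v)" and j: "j = 0 \<or> j = 1 \<or> j = 2"
      using h by (rule triangle_model_carrierE)
    obtain k' w z where [simp]: "k = (k', w, z)" and k': "k' = 0 \<or> k' = 1 \<or> k' = 2"
      using k by (rule triangle_model_carrierE)
    have "(i + 4) mod 3 = (1 + i) mod 3"
      by presburger
    then show ?thesis
      using j k' by (elim disjE)
        (simp_all add: triangle_model_mult spin_def mod_simps mod_spin, simp_all add: algebra_simps)
  qed
  show "\<one>\<^bsub>?M\<^esub> \<otimes>\<^bsub>?M\<^esub> g = g" if "g \<in> carrier ?M" for g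
    using that by (auto simp: triangle_model_def spin_def)
  show "\<exists>h\<in>carrier ?M. h \<otimes>\<^bsub>?M\<^esub> g = \<one>\<^bsub>?M\<^esub>" if g: "g \<in> carrier ?M" for g
  proof -
    obtain i s t where [simp]: "g = (i, s, t)" and i: "i = 0 \<or> i = 1 \<or> i = 2"
      using g by (rule triangle_model_carrierE)
    let ?s = "if i = 0 then - s else if i = 1 then - t else s + t"
    let ?t = "if i = 0 then - t else if i = 1 then s + t else - s"
    show ?thesis
      by (rule bexI[of _ "(- i mod 3, ?s mod int n, ?t mod int n)"])
        (use i assms in \<open>auto simp: triangle_model_def spin_def mod_simps mod_spin\<close>)
  qed
qed

text \<open>
  The image of \<open>y = xa\<close> has to be \<open>(1, 1, 0)\<close>.
\<close>

lemma grp_to_triangle_model: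
  assumes "1 < n"
  obtains \<phi> where "\<phi> \<in> hom (grp n) (triangle_model n)" "\<phi> (gx n) = (1, 0, 0)"
    "\<phi> (x2y n) = (0, 1, 0)" "\<phi> (xy2 n) = (0, 0, 1)"
proof -
  let ?M = "triangle_model n"
  interpret M: group ?M
    using assms by (intro group_triangle_model) simp
  have closed: "(i, s, t) \<in> carrier ?M \<longleftrightarrow> i \<in> {0..<3} \<and> s \<in> {0..<int n} \<and> t \<in> {0..<int n}" for i s t
    by (simp add: triangle_model_def)
  have one: "\<one>\<^bsub>?M\<^esub> = (0, 0, 0)"
    by (simp add: triangle_model_def)
  have a_eq: "inv\<^bsub>?M\<^esub> (1, 0, 0) \<otimes>\<^bsub>?M\<^esub> (1, 1, 0) = (0, 1, 0)"
    using assms M.inv_solve_left[of "(0, 1, 0)" "(1, 0, 0)" "(1, 1, 0)"]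
    by (simp add: closed triangle_model_mult spin_def)
  have b_eq: "(1, 0, 0) \<otimes>\<^bsub>?M\<^esub> inv\<^bsub>?M\<^esub> (1, 1, 0) = (0, 0, 1)"
    using assms M.inv_solve_right[of "(0, 0, 1)" "(1, 0, 0)" "(1, 1, 0)"]
    by (simp add: closed triangle_model_mult spin_def)
  have a_pow: "(0, 1, 0) [^]\<^bsub>?M\<^esub> m = (0, int m mod int n, 0)" for m :: nat
    by (induction m) (simp_all add: one triangle_model_mult spin_def mod_simps add.commute)
  obtain \<phi> where \<phi>: "\<phi> \<in> hom (grp n) ?M" "\<phi> (gx n) = (1, 0, 0)" "\<phi> (gy n) = (1, 1, 0)"
  proof (rule grp_universal[OF M.is_group, of "(1, 0, 0)" "(1, 1, 0)" n])
    show "(inv\<^bsub>?M\<^esub> (1, 0, 0) \<otimes>\<^bsub>?M\<^esub> (1, 1, 0)) [^]\<^bsub>?M\<^esub> n = \<one>\<^bsub>?M\<^esub>"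
      by (simp add: a_eq a_pow one)
  qed (use assms in \<open>simp_all add: closed one triangle_model_mult spin_def numeral_3_eq_3 mod_simps\<close>)
  interpret group "grp n" by (rule group_grp)
  interpret \<phi>: group_hom "grp n" ?M \<phi>
    using \<phi>(1) by unfold_locales
  show thesis
  proof (rule that[OF \<phi>(1,2)])
    show "\<phi> (x2y n) = (0, 1, 0)" "\<phi> (xy2 n) = (0, 0, 1)"
      by (simp_all add: x2y_eq xy2_eq gx_closed gy_closed \<phi> a_eq b_eq)
  qed
qed

text \<open>
  The model separates translations from each other by its last two components, and \<open>x\<close> from the
  translations by its first one.
\<close>

lemma triangle_group_grp:
  assumes "1 < n"
  shows "triangle_group (grp n) n (gx n) (x2y n) (xy2 n)"
proof -
  interpret triangle_relations "grp n" n "gx n" "x2y n" "xy2 n"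
    by (rule triangle_relations_grp)
  let ?M = "triangle_model n"
  obtain \<phi> where hom: "\<phi> \<in> hom (grp n) ?M" and \<phi>: "\<phi> (gx n) = (1, 0, 0)"
    "\<phi> (x2y n) = (0, 1, 0)" "\<phi> (xy2 n) = (0, 0, 1)"
    using grp_to_triangle_model[OF assms] by blast
  interpret M: group ?M
    using assms by (intro group_triangle_model) simp
  interpret \<phi>: group_hom "grp n" ?M \<phi>
    using hom by unfold_locales
  have one: "\<one>\<^bsub>?M\<^esub> = (0, 0, 0)"
    by (simp add: triangle_model_def)
  have pow: "(0, 1, 0) [^]\<^bsub>?M\<^esub> m = (0, int m mod int n, 0)"
    "(0, 0, 1) [^]\<^bsub>?M\<^esub> m = (0, 0, int m mod int n)" for m :: nat
    by (induction m) (simp_all add: one triangle_model_mult spin_def mod_simps add.commute)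
  have \<phi>_tr: "\<phi> (tr k l) = (0, k mod int n, l mod int n)" for k l
  proof -
    define k' l' where "k' = nat (k mod int n)" and "l' = nat (l mod int n)"
    have k'l': "int k' = k mod int n" "int l' = l mod int n"
      using assms by (simp_all add: k'_def l'_def)
    have "tr k l = tr (int k') (int l')"
      by (rule tr_cong) (simp_all add: k'l' cong_def)
    also have "\<dots> = x2y n [^]\<^bsub>grp n\<^esub> k' \<otimes>\<^bsub>grp n\<^esub> xy2 n [^]\<^bsub>grp n\<^esub> l'"
      by (simp add: tr_def int_pow_int)
    finally show ?thesis
      by (simp add: \<phi>.hom_nat_pow \<phi> pow triangle_model_mult spin_def k'l')
  qed
  show ?thesis
  proof
    let ?gen = "generate (grp n) {gx n, x2y n}"
    have gen: "subgroup ?gen (grp n)" "gx n \<in> ?gen" "x2y n \<in> ?gen"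
      by (auto intro: generate_is_subgroup generate.incl)
    have "gy n = gx n \<otimes>\<^bsub>grp n\<^esub> x2y n"
      by (simp add: x2y_eq gx_closed gy_closed flip: m_assoc)
    then have "gy n \<in> ?gen"
      using subgroup.m_closed[OF gen] by simp
    then have "generator (relators_333 n) c \<in> ?gen" for c
      using gen(2) by (cases c) (simp_all add: gx_def gy_def)
    then have "generate (grp n) (range (generator (relators_333 n))) \<subseteq> ?gen"
      using gen(1) by (intro generate_subgroup_incl) auto
    then show "?gen = carrier (grp n)"
      using generate_generators[of "relators_333 n"] subgroup.subset[OF gen(1)] by (simp add: grp_def)
    show "int n dvd k \<and> int n dvd l" if "tr k l = \<one>\<^bsub>grp n\<^esub>" for k l
      using \<phi>_tr[of k l] that by (simp add: one mod_eq_0_iff_dvd)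
    show "gx n \<noteq> tr k l" for k l
      using \<phi>_tr[of k l] \<phi>(1) by auto
  qed (fact assms)
qed

section \<open>The groups of order twelve and twenty-seven\<close>

text \<open>
  The homomorphism given by the presentation is injective because its image is not commutative, and
  then bijective because both groups have \<open>3n\<^sup>2\<close> elements.
\<close>

lemma grp_iso_of_noncommuting:
  assumes n: "n = 2 \<or> n = 3" and K: "group K" and card: "order K = 3 * n * n"
    and uv: "u \<in> carrier K" "v \<in> carrier K" "u \<otimes>\<^bsub>K\<^esub> v \<noteq> v \<otimes>\<^bsub>K\<^esub> u"
    and relations: "u [^]\<^bsub>K\<^esub> (3::nat) = \<one>\<^bsub>K\<^esub>" "v [^]\<^bsub>K\<^esub> (3::nat) = \<one>\<^bsub>K\<^esub>"
      "(u \<otimes>\<^bsub>K\<^esub> v) [^]\<^bsub>K\<^esub> (3::nat) = \<one>\<^bsub>K\<^esub>" "(inv\<^bsub>K\<^esub> u \<otimes>\<^bsub>K\<^esub> v) [^]\<^bsub>K\<^esub> n = \<one>\<^bsub>K\<^esub>"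
  shows "grp n \<cong> K"
proof -
  interpret K: group K by fact
  interpret triangle_group "grp n" n "gx n" "x2y n" "xy2 n"
    using n by (intro triangle_group_grp) auto
  obtain \<phi> where hom: "\<phi> \<in> hom (grp n) K" and \<phi>: "\<phi> (gx n) = u" "\<phi> (gy n) = v"
    using grp_universal[OF K uv(1,2) relations] by blast
  interpret \<phi>: group_hom "grp n" K \<phi>
    using hom by unfold_locales
  have a: "\<phi> (x2y n) = inv\<^bsub>K\<^esub> u \<otimes>\<^bsub>K\<^esub> v"
    by (simp add: x2y_eq gx_closed gy_closed \<phi>)
  have "\<phi> (gx n) \<otimes>\<^bsub>K\<^esub> \<phi> (x2y n) \<noteq> \<phi> (x2y n) \<otimes>\<^bsub>K\<^esub> \<phi> (gx n)"
  proof
    assume "\<phi> (gx n) \<otimes>\<^bsub>K\<^esub> \<phi> (x2y n) = \<phi> (x2y n) \<otimes>\<^bsub>K\<^esub> \<phi> (gx n)"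
    then have "u \<otimes>\<^bsub>K\<^esub> (inv\<^bsub>K\<^esub> u \<otimes>\<^bsub>K\<^esub> v) = inv\<^bsub>K\<^esub> u \<otimes>\<^bsub>K\<^esub> (v \<otimes>\<^bsub>K\<^esub> u)"
      using uv by (simp add: a \<phi> K.m_assoc)
    then have "v = inv\<^bsub>K\<^esub> u \<otimes>\<^bsub>K\<^esub> (v \<otimes>\<^bsub>K\<^esub> u)"
      using uv by (simp flip: K.m_assoc)
    then show False
      using uv K.inv_solve_left[of v u "v \<otimes>\<^bsub>K\<^esub> u"] by simp
  qed
  then have inj: "inj_on \<phi> (carrier (grp n))"
    by (rule inj_on_hom_if_noncommuting[OF n K hom])
  have "finite (carrier K)"
    using card n by (intro card_ge_0_finite) (auto simp: order_def)
  then have "\<phi> ` carrier (grp n) = carrier K"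
    using card_image[OF inj] order_G card by (intro card_subset_eq) (auto simp: order_def)
  then have "\<phi> \<in> iso (grp n) K"
    using inj hom by (simp add: iso_def bij_betw_def)
  then show ?thesis
    by (auto simp: is_iso_def)
qed

text \<open>
  The generators are the three-cycles \<open>(1 2 3)\<close> and \<open>(1 3 4) = (1 2 3) (1 2) (3 4)\<close>; their product is
  the three-cycle \<open>(2 3 4)\<close>.
\<close>

lemma grp_2_iso_alt_group: "grp 2 \<cong> alt_group 4"
proof -
  let ?u = "transpose 1 2 \<circ> transpose 2 3 :: nat \<Rightarrow> nat"
  let ?w = "transpose 1 2 \<circ> transpose 3 4 :: nat \<Rightarrow> nat"
  let ?A = "alt_group 4"
  interpret A: group ?A by (rule alt_group_is_group)
  have even: "transpose i j \<circ> transpose k l \<in> carrier ?A"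
    if "i \<in> {1..4}" "j \<in> {1..4}" "k \<in> {1..4}" "l \<in> {1..4}" "i \<noteq> j" "k \<noteq> l" for i j k l :: nat
    using that unfolding alt_group_carrier
    by (auto intro!: permutes_compose permutes_swap_id simp: evenperm_comp permutation_swap_id evenperm_swap)
  have uw: "?u \<in> carrier ?A" "?w \<in> carrier ?A"
    by (rule even; simp)+
  have three_cycle: "f [^]\<^bsub>?A\<^esub> (3::nat) = \<one>\<^bsub>?A\<^esub>"
    if "f p = q" "f q = r" "f r = p" "\<And>i. i \<noteq> p \<Longrightarrow> i \<noteq> q \<Longrightarrow> i \<noteq> r \<Longrightarrow> f i = i" for f p q r
  proof -
    have "f (f (f i)) = i" for i
      using that by metis
    then show ?thesis
      by (simp add: numeral_3_eq_3 alt_group_mult alt_group_one fun_eq_iff)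
  qed
  show ?thesis
  proof (rule grp_iso_of_noncommuting)
    show "?u \<in> carrier ?A" "?u \<otimes>\<^bsub>?A\<^esub> ?w \<in> carrier ?A"
      using uw by simp_all
    show "order ?A = 3 * 2 * 2"
      using alt_group_card_carrier[of 4] by (simp add: order_def fact_numeral)
    have "inv\<^bsub>?A\<^esub> ?u \<otimes>\<^bsub>?A\<^esub> (?u \<otimes>\<^bsub>?A\<^esub> ?w) = ?w"
      using uw by (simp flip: A.m_assoc)
    moreover have "?w [^]\<^bsub>?A\<^esub> (2::nat) = \<one>\<^bsub>?A\<^esub>"
      by (simp add: numeral_2_eq_2 alt_group_mult alt_group_one fun_eq_iff transpose_def)
    ultimately show "(inv\<^bsub>?A\<^esub> ?u \<otimes>\<^bsub>?A\<^esub> (?u \<otimes>\<^bsub>?A\<^esub> ?w)) [^]\<^bsub>?A\<^esub> (2::nat) = \<one>\<^bsub>?A\<^esub>"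
      by simp
    have "(?u \<circ> (?u \<circ> ?w)) 1 \<noteq> ((?u \<circ> ?w) \<circ> ?u) 1"
      by (simp add: transpose_def)
    then show "?u \<otimes>\<^bsub>?A\<^esub> (?u \<otimes>\<^bsub>?A\<^esub> ?w) \<noteq> (?u \<otimes>\<^bsub>?A\<^esub> ?w) \<otimes>\<^bsub>?A\<^esub> ?u"
      unfolding alt_group_mult by metis
    show "?u [^]\<^bsub>?A\<^esub> (3::nat) = \<one>\<^bsub>?A\<^esub>"
      by (rule three_cycle[of _ 1 2 3]) (simp_all add: transpose_def)
    show "(?u \<otimes>\<^bsub>?A\<^esub> ?w) [^]\<^bsub>?A\<^esub> (3::nat) = \<one>\<^bsub>?A\<^esub>"
      by (rule three_cycle[of _ 1 3 4]) (simp_all add: alt_group_mult transpose_def)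
    show "(?u \<otimes>\<^bsub>?A\<^esub> (?u \<otimes>\<^bsub>?A\<^esub> ?w)) [^]\<^bsub>?A\<^esub> (3::nat) = \<one>\<^bsub>?A\<^esub>"
      by (rule three_cycle[of _ 2 3 4]) (simp_all add: alt_group_mult transpose_def)
  qed (simp_all add: alt_group_is_group)
qed

text \<open>
  Rotations have order three for every \<open>n\<close>; translations do for \<open>n = 3\<close>.
\<close>

lemma (in triangle_group) pow_3_eq_one:
  assumes "n = 3" "g \<in> carrier G"
  shows "g [^] (3::nat) = \<one>"
  using assms(2)
proof (cases g rule: elementE)
  case (translation k l)
  then show ?thesis
    using assms(1) by (simp add: tr_nat_pow tr_eq_one_iff)
next
  case (rotation s t)
  then show ?thesis
    by (simp add: numeral_3_eq_3 m_assoc rot_cubed)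
next
  case (inverse_rotation s t)
  moreover have "rot s t [^] (3::nat) = \<one>"
    by (simp add: numeral_3_eq_3 m_assoc rot_cubed)
  ultimately show ?thesis
    by (simp add: nat_pow_inv)
qed

lemma nonabelian_27_exp_3_grp_3: "nonabelian_27_exp_3 (grp 3)"
proof -
  interpret triangle_group "grp 3" 3 "gx 3" "x2y 3" "xy2 3"
    by (rule triangle_group_grp) simp
  have "group_exponent (grp 3) = 3"
    unfolding group_exponent_def
  proof (rule Least_equality)
    fix m :: nat assume m: "0 < m \<and> (\<forall>g\<in>carrier (grp 3). g [^]\<^bsub>grp 3\<^esub> m = \<one>\<^bsub>grp 3\<^esub>)"
    then have "tr (int m) 0 = \<one>\<^bsub>grp 3\<^esub>"
      using tr_nat_pow[of 1 0 m] by simp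
    then have "int 3 dvd int m"
      using tr_free by blast
    then show "3 \<le> m"
      using m by (auto dest: zdvd_imp_le)
  qed (simp add: pow_3_eq_one)
  moreover have "\<not> comm_group (grp 3)"
  proof
    assume "comm_group (grp 3)"
    then interpret comm_group "grp 3" .
    show False
      using not_commutative m_comm[OF x_closed a_closed] by (rule notE)
  qed
  ultimately show ?thesis
    by (simp add: nonabelian_27_exp_3_def is_group order_G)
qed

lemma grp_3_iso_if_nonabelian_27_exp_3:
  assumes "nonabelian_27_exp_3 K"
  shows "grp 3 \<cong> K"
proof -
  have K: "group K" "\<not> comm_group K" "order K = 27" "group_exponent K = 3"
    using assms by (auto simp: nonabelian_27_exp_3_def)
  interpret K: group K by fact
  have "0 < (27::nat) \<and> (\<forall>g\<in>carrier K. g [^]\<^bsub>K\<^esub> (27::nat) = \<one>\<^bsub>K\<^esub>)"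
    using K.pow_order_eq_1 K(3) by simp
  then have "\<forall>g\<in>carrier K. g [^]\<^bsub>K\<^esub> group_exponent K = \<one>\<^bsub>K\<^esub>"
    unfolding group_exponent_def by (rule LeastI2) simp
  then have exp: "g [^]\<^bsub>K\<^esub> (3::nat) = \<one>\<^bsub>K\<^esub>" if "g \<in> carrier K" for g
    using that K(4) by simp
  obtain u v where uv: "u \<in> carrier K" "v \<in> carrier K" "u \<otimes>\<^bsub>K\<^esub> v \<noteq> v \<otimes>\<^bsub>K\<^esub> u"
    using K(2) K.group_comm_groupI by blast
  show ?thesis
    by (rule grp_iso_of_noncommuting[OF _ K(1) _ uv]) (simp_all add: K(3) uv exp)
qed

section \<open>Cyclic groups, subgroups of prime order and joins\<close>

lemma (in group) generate_singleton_iso_integer_mod_group: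
  assumes "g \<in> carrier G" "ord g \<noteq> 0"
  shows "G\<lparr>carrier := generate G {g}\<rparr> \<cong> integer_mod_group (ord g)"
proof -
  let ?Z = "integer_mod_group (ord g)" and ?C = "G\<lparr>carrier := generate G {g}\<rparr>"
  have pow_mod: "g [^] (k mod int (ord g)) = g [^] k" for k :: int
    using assms(1) by (simp add: int_pow_eq mod_eq_dvd_iff flip: minus_mod_eq_mult_div)
  have "(\<lambda>k. g [^] (k::int)) \<in> iso ?Z ?C"
  proof (rule isoI)
    show "(\<lambda>k. g [^] (k::int)) \<in> hom ?Z ?C"
      using assms(1) by (intro homI) (auto simp: generate_pow pow_mod int_pow_mult)
    have "inj_on (\<lambda>k. g [^] (k::int)) {0..<int (ord g)}"
      using assms by (auto simp: inj_on_def int_pow_eq dest: zdvd_imp_le simp flip: mod_eq_dvd_iff)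
    moreover have "g [^] k \<in> (\<lambda>k. g [^] k) ` {0..<int (ord g)}" for k :: int
      by (rule image_eqI[of _ _ "k mod int (ord g)"]) (use assms(2) in \<open>simp_all add: pow_mod\<close>)
    ultimately show "bij_betw (\<lambda>k. g [^] (k::int)) (carrier ?Z) (carrier ?C)"
      using assms by (auto simp: bij_betw_def carrier_integer_mod_group generate_pow)
  qed
  then show ?thesis
    using group.iso_sym[OF group_integer_mod_group] by (auto simp: is_iso_def)
qed

lemma (in group) ord_eq_prime:
  assumes "g \<in> carrier G" "g \<noteq> \<one>" "prime q" "g [^] q = \<one>"
  shows "ord g = q"
proof -
  have "ord g dvd q"
    using assms pow_eq_id by blast
  moreover have "ord g \<noteq> 1"
    using assms ord_eq_1 by blast
  ultimately show ?thesis
    using assms(3) prime_nat_iff by blast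
qed

lemma (in group) card_subgroup_dvd:
  assumes "subgroup A G" "subgroup B G" "A \<subseteq> B"
  shows "card A dvd card B"
proof -
  interpret B: group "G\<lparr>carrier := B\<rparr>"
    by (rule subgroup_imp_group[OF assms(2)])
  have "card (rcosets\<^bsub>G\<lparr>carrier := B\<rparr>\<^esub> A) * card A = card B"
    using B.lagrange[OF subgroup_incl[OF assms]] by (simp add: order_def)
  then show ?thesis
    using dvd_triv_right by metis
qed

text \<open>
  Lagrange's theorem.
\<close>

lemma (in group) subgroup_of_prime_card:
  assumes A: "subgroup A G" and prime: "prime (card A)" and B: "subgroup B G" "B \<subseteq> A"
  shows "B = {\<one>} \<or> B = A"
proof -
  have fin: "finite A"
    using prime not_prime_0 by (metis card.infinite)
  have "card B = 1 \<or> card B = card A"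
    using card_subgroup_dvd[OF B(1) A B(2)] prime prime_nat_iff by blast
  then show ?thesis
    using subgroup.one_closed[OF B(1)] card_subset_eq[OF fin B(2)]
    by (metis card_1_singletonE singletonD)
qed

lemma (in group) minimal_subgroup_if_prime_card:
  assumes "subgroup A G" "prime (card A)"
  shows "minimal_subgroup A G"
  using assms subgroup_of_prime_card[OF assms] not_prime_1 unfolding minimal_subgroup_def
  by (metis is_singletonI is_singleton_altdef)

lemma (in group) subgroup_join_least:
  assumes "subgroup C G" "A \<subseteq> C" "B \<subseteq> C"
  shows "subgroup_join G A B \<subseteq> C"
  unfolding subgroup_join_def by (rule generate_subgroup_incl) (use assms in auto)

lemma subgroup_join_upper: "A \<subseteq> subgroup_join G A B" "B \<subseteq> subgroup_join G A B"
  by (auto simp: subgroup_join_def intro: generate.incl)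

lemma (in group) subgroup_subgroup_join:
  "subgroup A G \<Longrightarrow> subgroup B G \<Longrightarrow> subgroup (subgroup_join G A B) G"
  unfolding subgroup_join_def by (rule generate_is_subgroup) (auto dest: subgroup.subset)

lemma (in group) generate_singleton_subset_iff:
  assumes "subgroup A G"
  shows "generate G {g} \<subseteq> A \<longleftrightarrow> g \<in> A"
  using assms generate_subgroup_incl[of "{g}" A] generate.incl[of g "{g}" G] by auto

section \<open>Primitive cube roots of unity modulo a prime\<close>

text \<open>
  This rests on \<open>i\<^sup>3 - 1 = (i - 1) (1 + i + i\<^sup>2)\<close>.  The second factor has the values \<open>1\<close> and \<open>3\<close> at
  \<open>i = 0\<close> and \<open>i = 1\<close>, which are not divisible by \<open>p\<close>.
\<close>

lemma cube_root_iff: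
  assumes "prime p" "3 < p" "i < p"
  shows "i \<in> cube_roots p \<longleftrightarrow> int p dvd 1 + int i + int i ^ 2"
proof
  assume "i \<in> cube_roots p"
  then have i: "1 < i" "i < p" "[int i ^ 3 = 1] (mod int p)"
    by (simp_all add: cube_roots_def flip: cong_int_iff)
  then have "int p dvd (int i - 1) * (1 + int i + int i ^ 2)"
    by (simp add: cong_iff_dvd_diff algebra_simps power2_eq_square power3_eq_cube)
  moreover have "\<not> int p dvd int i - 1"
    using i zdvd_imp_le[of "int p" "int i - 1"] by auto
  ultimately show "int p dvd 1 + int i + int i ^ 2"
    using assms(1) prime_dvd_mult_iff[of "int p"] by simp
next
  assume dvd: "int p dvd 1 + int i + int i ^ 2"
  have "\<not> int p dvd 1" "\<not> int p dvd 3"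
    using assms(2) zdvd_imp_le[of "int p" 1] zdvd_imp_le[of "int p" 3] by auto
  then have "i \<noteq> 0" "i \<noteq> 1"
    using dvd by (intro notI; simp)+
  moreover have "int p dvd (int i - 1) * (1 + int i + int i ^ 2)"
    using dvd by simp
  then have "[int i ^ 3 = 1] (mod int p)"
    by (simp add: cong_iff_dvd_diff algebra_simps power2_eq_square power3_eq_cube)
  then have "[i ^ 3 = 1] (mod p)"
    by (simp flip: cong_int_iff)
  ultimately show "i \<in> cube_roots p"
    using assms by (auto simp: cube_roots_def)
qed

text \<open>
  A non-trivial cube root of unity has order three, and orders divide \<open>p - 1\<close>.
\<close>

lemma cube_roots_empty:
  assumes p: "prime p" "3 < p" and "\<not> 3 dvd p - 1"
  shows "cube_roots p = {}"
proof -
  have False if "i \<in> cube_roots p" for i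
  proof -
    have i: "1 < i" "i < p" "[i ^ 3 = 1] (mod p)"
      using that by (auto simp: cube_roots_def)
    have "ord p i dvd 3"
      using i(3) ord_divides by blast
    moreover have "ord p i \<noteq> 1"
      using i ord_eq_Suc_0_iff[of p i] by (auto simp: cong_def)
    ultimately have "ord p i = 3"
      using prime_nat_iff[of 3] by auto
    moreover have "\<not> p dvd i"
      using i by (auto dest: dvd_imp_le)
    then have "coprime p i"
      using p(1) prime_imp_coprime by blast
    ultimately show False
      using assms(3) order_divides_totient[of p i] totient_prime[OF p(1)] by simp
  qed
  then show ?thesis by blast
qed

text \<open>
  A suitable power \<open>i\<close> of a primitive root is one solution.  The other one is \<open>- 1 - i\<close>, because the
  two roots of \<open>1 + i + i\<^sup>2\<close> have the sum \<open>- 1\<close>; they differ because the discriminant is \<open>- 3\<close>.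
\<close>

lemma card_cube_roots:
  assumes p: "prime p" "3 < p" and "3 dvd p - 1"
  shows "card (cube_roots p) = 2"
proof -
  obtain g where g: "coprime p g" "ord p g = p - 1"
    using prime_primitive_root_exists[of p] p totient_prime[OF p(1)]
    by (auto simp: residue_primroot_def)
  obtain q where q: "p - 1 = 3 * q"
    using assms(3) by blast
  then have q_pos: "0 < q" "q < p - 1"
    using p(2) by auto
  define i where "i = g ^ q mod p"
  have "[g ^ (3 * q) = 1] (mod p)"
    using ord_divides[of g "3 * q" p] g(2) q by simp
  then have "[i ^ 3 = 1] (mod p)"
    by (simp add: i_def cong_def power_mod mult.commute flip: power_mult)
  moreover have "[i \<noteq> 1] (mod p)"
    using ord_divides[of g q p] g(2) q_pos by (auto simp: i_def cong_def dest: dvd_imp_le)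
  moreover from this have "i \<noteq> 1"
    by auto
  moreover have "i \<noteq> 0"
    using calculation(1) p(2) by (intro notI) (simp add: cong_def)
  ultimately have i: "i \<in> cube_roots p"
    using p(2) by (auto simp: cube_roots_def i_def)
  then have "i < p" and dvd: "int p dvd 1 + int i + int i ^ 2"
    using cube_root_iff[OF p] by (auto simp: cube_roots_def)
  have iff: "j \<in> cube_roots p \<longleftrightarrow> j = i \<or> j = p - 1 - i" if "j < p" for j
  proof -
    have "j \<in> cube_roots p \<longleftrightarrow> int p dvd (1 + int j + int j ^ 2) - (1 + int i + int i ^ 2)"
      using cube_root_iff[OF p that] dvd dvd_diff_left_iff by blast
    also have "(1 + int j + int j ^ 2) - (1 + int i + int i ^ 2) = (int j - int i) * (int j + int i + 1)"
      by (simp add: algebra_simps power2_eq_square)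
    also have "int p dvd \<dots> \<longleftrightarrow> int p dvd int j - int i \<or> int p dvd int j + int i + 1"
      using p(1) by (simp add: prime_dvd_mult_iff)
    also have "int p dvd int j - int i \<longleftrightarrow> j = i"
      using that \<open>i < p\<close> by (auto simp flip: cong_iff_dvd_diff simp: cong_int_iff cong_less_modulus_unique_nat)
    also have "int p dvd int j + int i + 1 \<longleftrightarrow> p dvd j + i + 1"
      using int_dvd_int_iff[of p "j + i + 1"] by (simp add: add_ac)
    also have "\<dots> \<longleftrightarrow> j = p - 1 - i"
    proof
      assume "p dvd j + i + 1"
      then obtain c where c: "j + i + 1 = p * c" ..
      have "p * c < p * 2"
        using that \<open>i < p\<close> c by linarith
      then have "c < 2"
        by simp
      moreover have "c \<noteq> 0"
        using c by (intro notI) simp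
      ultimately have "c = 1" by simp
      then show "j = p - 1 - i" using c by simp
    qed (use \<open>i < p\<close> in simp)
    finally show ?thesis .
  qed
  have "i \<noteq> p - 1 - i"
  proof
    assume "i = p - 1 - i"
    then have "int p = 2 * int i + 1"
      using \<open>i < p\<close> by linarith
    then have "4 * (1 + int i + int i ^ 2) = int p * int p + 3"
      by (simp add: algebra_simps power2_eq_square)
    then have "int p dvd 3"
      using dvd by (metis dvd_add_right_iff dvd_mult dvd_triv_left)
    then show False
      using p(2) zdvd_imp_le by fastforce
  qed
  moreover have "cube_roots p = {i, p - 1 - i}"
  proof -
    have "j < p" if "j \<in> cube_roots p" for j
      using that by (simp add: cube_roots_def)
    then show ?thesis
      using iff i \<open>i < p\<close> by (auto)
  qed
  ultimately show ?thesis by simp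
qed

section \<open>The affine plane over a prime field\<close>

locale triangle_group_prime = triangle_group +
  assumes prime_n: "prime n" and n_gt_3: "3 < n"
begin

lemma prime_int_n: "prime (int n)"
  using prime_n by simp

text \<open>
  The residues modulo \<open>n\<close> now form a field, and linear algebra over it is done with divisibility of
  integers by \<open>n\<close>.
\<close>

lemma coprime_n_iff: "coprime k (int n) \<longleftrightarrow> \<not> int n dvd k"
  using prime_int_n by (metis coprime_commute coprime_absorb_left not_prime_unit prime_imp_coprime)

lemma not_n_dvd_3: "\<not> int n dvd 3"
  using n_gt_3 zdvd_imp_le[of "int n" 3] by auto

lemma ex_inverse:
  assumes "\<not> int n dvd k"
  obtains c where "int n dvd k * c - 1"
  using cong_solve_coprime_int[of k "int n"] assms coprime_n_iff[of k]
  by (auto simp: cong_iff_dvd_diff)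

text \<open>
  The translations along the line through the origin and \<open>(k, l)\<close>.
\<close>

definition line :: "int \<Rightarrow> int \<Rightarrow> 'a set" where
  "line k l = generate G {tr k l}"

lemma line_eq: "line k l = {tr (m * k) (m * l) | m. True}"
  by (simp add: line_def generate_pow tr_pow full_SetCompr_eq)

lemma subgroup_line [simp]: "subgroup (line k l) G"
  unfolding line_def by (rule generate_is_subgroup) simp

lemma line_subset: "line k l \<subseteq> translation_group"
  by (auto simp: line_eq)

lemma tr_in_line: "tr k l \<in> line k l"
  by (simp add: line_def generate.incl)

lemma line_subset_iff: "subgroup A G \<Longrightarrow> line k l \<subseteq> A \<longleftrightarrow> tr k l \<in> A"
  unfolding line_def by (rule generate_singleton_subset_iff)

lemma ord_tr: "tr k l \<noteq> \<one> \<Longrightarrow> ord (tr k l) = n"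
  by (rule ord_eq_prime) (simp_all add: prime_n tr_nat_pow tr_eq_one_iff)

lemma card_line: "tr k l \<noteq> \<one> \<Longrightarrow> card (line k l) = n"
  using generate_pow_card[of "tr k l"] ord_tr[of k l] by (simp add: line_def)

text \<open>
  Collinearity is expressed by a vanishing determinant.
\<close>

lemma tr_in_line_iff:
  assumes "tr k l \<noteq> \<one>"
  shows "tr u v \<in> line k l \<longleftrightarrow> int n dvd k * v - l * u"
proof
  assume "tr u v \<in> line k l"
  then obtain m where "int n dvd u - m * k" "int n dvd v - m * l"
    by (auto simp: line_eq tr_eq_iff cong_iff_dvd_diff)
  then have "int n dvd k * (v - m * l) - l * (u - m * k)"
    by (intro dvd_diff[OF dvd_mult dvd_mult])
  then show "int n dvd k * v - l * u"
    by (simp add: algebra_simps)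
next
  assume det: "int n dvd k * v - l * u"
  have witness: "tr u v \<in> line k l" if "int n dvd u - m * k" "int n dvd v - m * l" for m
    using that by (auto simp: line_eq tr_eq_iff cong_iff_dvd_diff)
  have "\<not> int n dvd k \<or> \<not> int n dvd l"
    using assms by (simp add: tr_eq_one_iff)
  then show "tr u v \<in> line k l"
  proof
    assume "\<not> int n dvd k"
    then obtain c where c: "int n dvd k * c - 1"
      by (rule ex_inverse)
    have "u - (c * u) * k = - u * (k * c - 1)" "v - (c * u) * l = c * (k * v - l * u) - v * (k * c - 1)"
      by (simp_all add: algebra_simps)
    then show ?thesis
      using witness[of "c * u"] c det by (metis dvd_diff dvd_mult)
  next
    assume "\<not> int n dvd l"
    then obtain c where c: "int n dvd l * c - 1"
      by (rule ex_inverse)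
    have "v - (c * v) * l = - v * (l * c - 1)" "u - (c * v) * k = (- c) * (k * v - l * u) - u * (l * c - 1)"
      by (simp_all add: algebra_simps)
    then show ?thesis
      using witness[of "c * v"] c det by (metis dvd_diff dvd_mult)
  qed
qed

lemma line_eq_iff:
  assumes "tr k l \<noteq> \<one>" "tr u v \<noteq> \<one>"
  shows "line k l = line u v \<longleftrightarrow> int n dvd k * v - l * u"
proof
  assume "line k l = line u v"
  then show "int n dvd k * v - l * u"
    using tr_in_line_iff[OF assms(1), of u v] tr_in_line[of u v] by simp
next
  assume "int n dvd k * v - l * u"
  then have "line u v \<subseteq> line k l"
    using tr_in_line_iff[OF assms(1), of u v] by (simp add: line_subset_iff)
  moreover have "finite (line k l)"
    by (rule finite_subset[OF line_subset finite_translations])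
  ultimately show "line k l = line u v"
    using card_subset_eq card_line[OF assms(1)] card_line[OF assms(2)] by metis
qed

lemma tr_1_neq_one [simp]: "tr 1 i \<noteq> \<one>"
  using prime_int_n not_prime_unit by (auto simp: tr_eq_one_iff)

lemma tr_0_1_neq_one [simp]: "tr 0 1 \<noteq> \<one>"
  using prime_int_n not_prime_unit by (auto simp: tr_eq_one_iff)

lemma line_slope:
  assumes "tr k l \<noteq> \<one>"
  obtains (slope) i where "i < n" "line k l = line 1 (int i)" | (vertical) "line k l = line 0 1"
proof (cases "int n dvd k")
  case True
  then have "line k l = line 0 1"
    using assms by (simp add: line_eq_iff)
  then show ?thesis by (rule vertical)
next
  case False
  then obtain c where c: "int n dvd k * c - 1"
    by (rule ex_inverse)
  define i where "i = nat ((c * l) mod int n)"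
  have i: "int i = (c * l) mod int n"
    using n_gt_1 by (simp add: i_def)
  then have "i < n"
    using n_gt_1 by (metis of_nat_0_less_iff of_nat_less_iff pos_mod_bound gr_implies_not0 gr0I)
  moreover have "int n dvd k * (c * l - int i)"
    unfolding i by (simp add: minus_mod_eq_mult_div)
  then have "int n dvd l * (k * c - 1) - k * (c * l - int i)"
    by (rule dvd_diff[OF dvd_mult[OF c]])
  then have "int n dvd k * int i - l * 1"
    by (simp add: algebra_simps)
  then have "line k l = line 1 (int i)"
    using assms by (simp add: line_eq_iff)
  ultimately show ?thesis by (rule slope)
qed

text \<open>
  These are the linear subspaces of the plane: over a prime field every subgroup is a subspace.
\<close>

lemma subgroup_of_translations_cases:
  assumes A: "subgroup A G" "A \<subseteq> translation_group"
  obtains "A = {\<one>}" | k l where "tr k l \<noteq> \<one>" "A = line k l" | "A = translation_group"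
proof (cases "A = {\<one>}")
  case False
  then obtain g where "g \<in> A" "g \<noteq> \<one>"
    using subgroup.one_closed[OF A(1)] by blast
  then obtain k l where kl: "tr k l \<in> A" "tr k l \<noteq> \<one>"
    using A(2) by (auto simp: translation_group_def)
  show ?thesis
  proof (cases "A \<subseteq> line k l")
    case True
    then show ?thesis
      using that(2)[OF kl(2)] kl(1) line_subset_iff[OF A(1)] by blast
  next
    case False
    then obtain g where "g \<in> A" "g \<notin> line k l"
      by blast
    then obtain u v where uv: "tr u v \<in> A" "tr u v \<notin> line k l"
      using A(2) by (auto simp: translation_group_def)
    then have "coprime (k * v - l * u) (int n)"
      by (simp add: coprime_n_iff tr_in_line_iff[OF kl(2)])
    then have "translation_group \<subseteq> A"
      by (rule translations_subset_of_basis[OF A(1) kl(1) uv(1)])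
    then show ?thesis
      using that(3) A(2) by blast
  qed
qed (use that(1) in blast)

subsection \<open>Rotations about points\<close>

text \<open>
  The rotation about the point \<open>v = (k, l)\<close>, which is the conjugate \<open>v\<inverse>xv = x (v - R v)\<close> of the
  rotation about the origin: here \<open>v - R v = (2k + l, l - k)\<close>.
\<close>

definition pt_rot :: "int \<Rightarrow> int \<Rightarrow> 'a" where
  "pt_rot k l = rot (2 * k + l) (l - k)"

text \<open>
  The point \<open>(k, l)\<close> is fixed by exactly these elements.
\<close>

definition stab :: "int \<Rightarrow> int \<Rightarrow> 'a set" where
  "stab k l = generate G {pt_rot k l}"

lemma pt_rot_closed [simp]: "pt_rot k l \<in> carrier G"
  by (simp add: pt_rot_def)

lemma pt_rot_eq_conj: "pt_rot k l = tr (- k) (- l) \<otimes> x \<otimes> tr k l"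
  using tr_mult_rot[of "- k" "- l" k l] by (simp add: pt_rot_def rot_def m_assoc)

text \<open>
  Every rotation has a centre, because \<open>1 - R\<close> has determinant \<open>3\<close>: the centre of \<open>rot s t\<close> solves
  \<open>3k = s - t\<close> and \<open>3l = s + 2t\<close>.
\<close>

lemma rot_eq_pt_rot:
  obtains k l where "k < n" "l < n" "rot s t = pt_rot (int k) (int l)"
proof -
  obtain c where c: "int n dvd 3 * c - 1"
    using not_n_dvd_3 by (rule ex_inverse)
  define k where "k = nat ((c * (s - t)) mod int n)"
  define l where "l = nat ((c * (s + 2 * t)) mod int n)"
  have "k < n" "l < n"
    using n_gt_1 by (simp_all add: k_def l_def nat_less_iff)
  moreover have "[int k = c * (s - t)] (mod int n)" "[int l = c * (s + 2 * t)] (mod int n)"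
    using n_gt_1 by (simp_all add: k_def l_def)
  then have "[2 * int k + int l = 2 * (c * (s - t)) + c * (s + 2 * t)] (mod int n)"
    "[int l - int k = c * (s + 2 * t) - c * (s - t)] (mod int n)"
    by (blast intro: cong_add cong_diff cong_scalar_left)+
  moreover have "[s * (3 * c) = s * 1] (mod int n)" "[t * (3 * c) = t * 1] (mod int n)"
    using c by (intro cong_scalar_left; simp add: cong_iff_dvd_diff)+
  moreover have "2 * (c * (s - t)) + c * (s + 2 * t) = s * (3 * c)"
    "c * (s + 2 * t) - c * (s - t) = t * (3 * c)"
    by (simp_all add: algebra_simps)
  ultimately have "rot s t = pt_rot (int k) (int l)"
    unfolding pt_rot_def rot_eq_iff by (metis cong_sym cong_trans mult_1_right)
  then show ?thesis
    using that \<open>k < n\<close> \<open>l < n\<close> by blast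
qed

lemma inv_pt_rot_mult_pt_rot:
  "inv pt_rot k l \<otimes> pt_rot k' l' = tr (2 * (k' - k) + (l' - l)) ((l' - l) - (k' - k))"
  by (simp add: pt_rot_def algebra_simps)

lemma subgroup_stab [simp]: "subgroup (stab k l) G"
  unfolding stab_def by (rule generate_is_subgroup) simp

lemma stab_subset_iff: "subgroup A G \<Longrightarrow> stab k l \<subseteq> A \<longleftrightarrow> pt_rot k l \<in> A"
  unfolding stab_def by (rule generate_singleton_subset_iff)

lemma pt_rot_in_stab [simp]: "pt_rot k l \<in> stab k l"
  by (simp add: stab_def generate.incl)

lemma ord_pt_rot: "ord (pt_rot k l) = 3"
proof (rule ord_eq_prime)
  show "pt_rot k l \<noteq> \<one>"
    unfolding pt_rot_def by (metis rot_neq_tr tr_0)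
  show "pt_rot k l [^] (3::nat) = \<one>"
    by (simp add: pt_rot_def numeral_3_eq_3 rot_cubed m_assoc)
qed simp_all

lemma card_stab: "card (stab k l) = 3"
  using generate_pow_card[of "pt_rot k l"] by (simp add: stab_def ord_pt_rot)

lemma stab_Int_translations: "stab k l \<inter> translation_group = {\<one>}"
proof -
  have "pt_rot k l \<notin> translation_group"
    by (simp add: pt_rot_def)
  then have "stab k l \<inter> translation_group \<noteq> stab k l"
    using pt_rot_in_stab by blast
  moreover have "subgroup (stab k l \<inter> translation_group) G"
    by (intro subgroups_Inter_pair subgroup_stab subgroup_translations)
  ultimately show ?thesis
    using subgroup_of_prime_card[OF subgroup_stab] card_stab by fastforce
qed

lemma pt_rot_in_if_not_translation:
  assumes A: "subgroup A G" "\<not> A \<subseteq> translation_group"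
  obtains k l where "k < n" "l < n" "pt_rot (int k) (int l) \<in> A"
proof -
  obtain g where g: "g \<in> A" "g \<notin> translation_group"
    using A(2) by blast
  have "g \<in> carrier G"
    using g subgroup.mem_carrier[OF A(1)] by blast
  then have "\<exists>s t. rot s t \<in> A"
  proof (cases g rule: elementE)
    case (inverse_rotation s t)
    then have "rot s t \<in> A"
      using subgroup.m_inv_closed[OF A(1) g(1)] by simp
    then show ?thesis by blast
  qed (use g in auto)
  then show ?thesis
    using that rot_eq_pt_rot by metis
qed

text \<open>
  The form \<open>k\<^sup>2 + kl + l\<^sup>2\<close> vanishes modulo \<open>n\<close> only if the direction \<open>(k, l)\<close> is \<open>R\<close>-invariant.  In all
  other directions a translation and its rotated image generate all translations.
\<close>

lemma eq_carrier_of_orbit: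
  assumes "subgroup A G" "pt_rot u v \<in> A" "tr k l \<in> A" "\<not> int n dvd k ^ 2 + k * l + l ^ 2"
  shows "A = carrier G"
proof -
  have "translation_group \<subseteq> A"
    using assms translations_subset_of_orbit[of A _ _ k l]
    by (auto simp: pt_rot_def coprime_n_iff)
  then show ?thesis
    using subgroup_eq_carrier assms by (auto simp: pt_rot_def)
qed

subsection \<open>Stabilizers of lines of invariant slope\<close>

text \<open>
  The roots of \<open>1 + i + i\<^sup>2\<close> differ from \<open>1\<close>, where this polynomial has the value \<open>3\<close>.
\<close>

lemma not_dvd_slope_minus_1:
  assumes "int n dvd 1 + i + i ^ 2"
  shows "\<not> int n dvd 1 - i"
proof
  assume "int n dvd 1 - i"
  then have "int n dvd (2 + i) * (1 - i) + (1 + i + i ^ 2)"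
    by (rule dvd_add[OF dvd_mult assms])
  then show False
    using not_n_dvd_3 by (simp add: algebra_simps power2_eq_square)
qed

text \<open>
  If \<open>1 + i + i\<^sup>2\<close> vanishes, these elements are the ones that map the line of slope \<open>i\<close> through \<open>(k, l)\<close>
  to itself.
\<close>

definition line_stab :: "int \<Rightarrow> int \<Rightarrow> int \<Rightarrow> 'a set" where
  "line_stab i k l = subgroup_join G (line 1 i) (stab k l)"

lemma subgroup_line_stab [simp]: "subgroup (line_stab i k l) G"
  unfolding line_stab_def by (rule subgroup_subgroup_join) simp_all

lemma line_subset_line_stab: "line 1 i \<subseteq> line_stab i k l"
  and stab_subset_line_stab: "stab k l \<subseteq> line_stab i k l"
  unfolding line_stab_def by (rule subgroup_join_upper)+

lemma pt_rot_in_line_stab: "pt_rot k l \<in> line_stab i k l"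
  using stab_subset_line_stab pt_rot_in_stab by blast

lemma tr_in_line_stab: "tr 1 i \<in> line_stab i k l"
  using line_subset_line_stab tr_in_line by blast

lemma line_stab_subset:
  "subgroup A G \<Longrightarrow> tr 1 i \<in> A \<Longrightarrow> pt_rot k l \<in> A \<Longrightarrow> line_stab i k l \<subseteq> A"
  unfolding line_stab_def by (rule subgroup_join_least) (simp_all add: line_subset_iff stab_subset_iff)

text \<open>
  A line through the origin whose slope is a root of \<open>1 + i + i\<^sup>2\<close> is invariant under \<open>R\<close>.
\<close>

lemma normal_line:
  assumes "int n dvd 1 + i + i ^ 2"
  shows "line 1 i \<lhd> G"
proof -
  have rotated: "tr l (- k - l) \<in> line 1 i" "tr (- k - l) k \<in> line 1 i"
    if "tr k l \<in> line 1 i" for k l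
  proof -
    have kl: "int n dvd l - i * k"
      using that by (simp add: tr_in_line_iff)
    have "(- k - l) - i * l = - (1 + i) * (l - i * k) - k * (1 + i + i ^ 2)"
      "k - i * (- k - l) = i * (l - i * k) + k * (1 + i + i ^ 2)"
      by (simp_all add: algebra_simps power2_eq_square)
    then show "tr l (- k - l) \<in> line 1 i" "tr (- k - l) k \<in> line 1 i"
      using dvd_diff[OF dvd_mult[OF kl] dvd_mult[OF assms]] dvd_add[OF dvd_mult[OF kl] dvd_mult[OF assms]]
      by (metis tr_in_line_iff tr_1_neq_one mult_1)+
  qed
  have "g \<otimes> h \<otimes> inv g \<in> line 1 i" if g: "g \<in> carrier G" and h_line: "h \<in> line 1 i" for g h
  proof -
    obtain k l where h: "h = tr k l"
      using subsetD[OF line_subset h_line] by (auto simp: translation_group_def)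
    from g show ?thesis
    proof (cases g rule: elementE)
      case (translation u v)
      then show ?thesis using h_line h by simp
    next
      case (rotation s t)
      then show ?thesis using rotated(1) h_line h by (simp only: conj_tr_by_rot)
    next
      case (inverse_rotation s t)
      then show ?thesis using rotated(2) h_line h by (simp only: inv_inv rot_closed conj_tr_by_inv_rot)
    qed
  qed
  then show ?thesis
    by (simp add: normal_inv_iff)
qed

text \<open>
  Since the line is normal, each element of the join is a translation along the line followed by an
  element of the point stabilizer, and the latter contains no translation but the identity.
\<close>

lemma line_stab_Int_translations:
  assumes "int n dvd 1 + i + i ^ 2"
  shows "line_stab i k l \<inter> translation_group = line 1 i"
proof
  have "subgroup (line 1 i <#> stab k l) G"
    by (rule mult_norm_subgroup[OF normal_line[OF assms] subgroup_stab])
  moreover have "tr 1 i \<in> line 1 i <#> stab k l"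
    using tr_in_line[of 1 i] subgroup.one_closed[OF subgroup_stab]
    unfolding set_mult_def by (metis (mono_tags, lifting) UN_iff singletonI tr_closed r_one)
  moreover have "pt_rot k l \<in> line 1 i <#> stab k l"
    using pt_rot_in_stab[of k l] subgroup.one_closed[OF subgroup_line]
    unfolding set_mult_def by (metis (mono_tags, lifting) UN_iff singletonI pt_rot_closed l_one)
  ultimately have join: "line_stab i k l \<subseteq> line 1 i <#> stab k l"
    by (rule line_stab_subset)
  show "line_stab i k l \<inter> translation_group \<subseteq> line 1 i"
  proof
    fix g assume g: "g \<in> line_stab i k l \<inter> translation_group"
    then obtain h s where hs: "h \<in> line 1 i" "s \<in> stab k l" "g = h \<otimes> s"
      using join by (auto simp: set_mult_def)
    have [simp]: "h \<in> carrier G" "s \<in> carrier G"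
      using hs subgroup.mem_carrier[OF subgroup_line] subgroup.mem_carrier[OF subgroup_stab] by blast+
    have "s = inv h \<otimes> g"
      using hs(3) by (simp flip: m_assoc)
    moreover have "inv h \<in> translation_group"
      using hs(1) line_subset subgroup.m_inv_closed[OF subgroup_translations] by blast
    ultimately have "s \<in> translation_group"
      using g subgroup.m_closed[OF subgroup_translations] by simp
    then have "s = \<one>"
      using hs(2) stab_Int_translations by blast
    then show "g \<in> line 1 i"
      using hs(1,3) by simp
  qed
qed (simp add: line_subset_line_stab line_subset)

text \<open>
  The quotient of the two rotations is a translation, so the previous lemma applies to it: it
  lies in the join if and only if its vector \<open>d - R d\<close> has slope \<open>i\<close>.  Here \<open>d\<close> is the difference of the
  two centres; since \<open>1 - R\<close> maps the invariant line onto itself, this means that \<open>d\<close> has slope \<open>i\<close>.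
\<close>

lemma pt_rot_in_line_stab_iff:
  assumes "int n dvd 1 + i + i ^ 2"
  shows "pt_rot k' l' \<in> line_stab i k l \<longleftrightarrow> int n dvd (l' - l) - i * (k' - k)"
proof -
  let ?g = "inv pt_rot k l \<otimes> pt_rot k' l'"
  define dk dl where "dk = k' - k" and "dl = l' - l"
  have "pt_rot k' l' \<in> line_stab i k l \<longleftrightarrow> ?g \<in> line_stab i k l"
  proof
    assume "?g \<in> line_stab i k l"
    then have "pt_rot k l \<otimes> ?g \<in> line_stab i k l"
      by (intro subgroup.m_closed[OF subgroup_line_stab pt_rot_in_line_stab])
    then show "pt_rot k' l' \<in> line_stab i k l"
      by (simp flip: m_assoc)
  qed (intro subgroup.m_closed[OF subgroup_line_stab] subgroup.m_inv_closed[OF subgroup_line_stab]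
      pt_rot_in_line_stab)
  also have "\<dots> \<longleftrightarrow> ?g \<in> line 1 i"
    unfolding inv_pt_rot_mult_pt_rot line_stab_Int_translations[OF assms, of k l, symmetric] by simp
  also have "\<dots> \<longleftrightarrow> int n dvd (dl - dk) - i * (2 * dk + dl)"
    unfolding inv_pt_rot_mult_pt_rot by (simp add: tr_in_line_iff dk_def dl_def)
  (* The determinants of (1, i) with d - R d and with d differ by the factor 1 - i, because
     R acts as the scalar i on the quotient of the plane by the line. *)
  also have "(dl - dk) - i * (2 * dk + dl) = (1 - i) * (dl - i * dk) - dk * (1 + i + i ^ 2)"
    by (simp add: algebra_simps power2_eq_square)
  also have "int n dvd \<dots> \<longleftrightarrow> int n dvd (1 - i) * (dl - i * dk)"
    using assms by (intro dvd_diff_left_iff) simp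
  also have "\<dots> \<longleftrightarrow> int n dvd dl - i * dk"
    using not_dvd_slope_minus_1[OF assms] by (simp add: prime_dvd_mult_iff[OF prime_int_n])
  finally show ?thesis
    by (simp add: dk_def dl_def)
qed

text \<open>
  Both groups contain the translations of slope \<open>i\<close>, so they agree as soon as each of them contains the
  rotation that generates the other one.
\<close>

lemma line_stab_eq_iff:
  assumes "int n dvd 1 + i + i ^ 2"
  shows "line_stab i k' l' = line_stab i k l \<longleftrightarrow> int n dvd (l' - l) - i * (k' - k)"
proof
  assume "line_stab i k' l' = line_stab i k l"
  then show "int n dvd (l' - l) - i * (k' - k)"
    using pt_rot_in_line_stab[of k' l' i] pt_rot_in_line_stab_iff[OF assms, of k' l' k l] by simp
next
  have sub: "line_stab i k' l' \<subseteq> line_stab i k l" if "int n dvd (l' - l) - i * (k' - k)" for k l k' l'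
    by (rule line_stab_subset)
      (use that pt_rot_in_line_stab_iff[OF assms] tr_in_line_stab in auto)
  assume dvd: "int n dvd (l' - l) - i * (k' - k)"
  moreover have "int n dvd (l - l') - i * (k - k')"
    using dvd_minus_iff[THEN iffD2, OF dvd] by (simp add: algebra_simps)
  ultimately show "line_stab i k' l' = line_stab i k l"
    using sub by blast
qed

lemma line_stab_neq_carrier:
  assumes "int n dvd 1 + i + i ^ 2"
  shows "line_stab i k l \<noteq> carrier G"
proof
  assume "line_stab i k l = carrier G"
  then have "translation_group \<subseteq> line_stab i k l"
    using subgroup.subset[OF subgroup_translations] by simp
  then have "line 1 i = translation_group"
    using line_stab_Int_translations[OF assms, of k l] by blast
  then have "n * n = n"
    using card_line[of 1 i] card_translations by simp
  then show False
    using n_gt_1 by simp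
qed

text \<open>
  The order of such a subgroup is a multiple of \<open>3n\<close> and divides \<open>3n\<^sup>2\<close>, with \<open>n\<close> prime.
\<close>

lemma subgroup_above_line_stab:
  assumes A: "subgroup A G" "line_stab i k l \<subseteq> A"
  shows "card A = 3 * n \<or> A = carrier G"
proof -
  have fin: "finite (carrier G)"
    using order_G n_gt_1 by (intro card_ge_0_finite) (simp add: order_def)
  have "n dvd card A"
    using card_subgroup_dvd[OF subgroup_line A(1)] A(2) line_subset_line_stab card_line[of 1 i]
    by (metis subset_trans tr_1_neq_one)
  moreover have "3 dvd card A"
    using card_subgroup_dvd[OF subgroup_stab A(1)] A(2) stab_subset_line_stab card_stab
    by (metis subset_trans)
  moreover have "coprime 3 n"
    using primes_coprime[of 3 n] prime_n n_gt_3 by simp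
  ultimately have "3 * n dvd card A"
    using divides_mult by blast
  then obtain c where c: "card A = 3 * n * c" ..
  have sub: "A \<subseteq> carrier G"
    by (rule subgroup.subset[OF A(1)])
  have "card A dvd 3 * n * n"
    using card_subgroup_dvd[OF A(1) subgroup_self sub] order_G by (simp add: order_def)
  then have "c dvd n"
    using c n_gt_1 by simp
  then have "c = 1 \<or> c = n"
    using prime_n prime_nat_iff by blast
  then show ?thesis
    using c card_subset_eq[OF fin sub] order_G by (auto simp: order_def)
qed

lemma card_line_stab:
  assumes "int n dvd 1 + i + i ^ 2"
  shows "card (line_stab i k l) = 3 * n"
  using subgroup_above_line_stab[OF subgroup_line_stab] line_stab_neq_carrier[OF assms] by blast

lemma maximal_line_stab:
  assumes "int n dvd 1 + i + i ^ 2"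
  shows "maximal_subgroup (line_stab i k l) G"
proof -
  have "A = line_stab i k l \<or> A = carrier G" if A: "subgroup A G" "line_stab i k l \<subseteq> A" for A
  proof (rule disjCI)
    assume "A \<noteq> carrier G"
    then have card: "card A = 3 * n"
      using subgroup_above_line_stab[OF A] by blast
    then have "finite A"
      using n_gt_1 by (intro card_ge_0_finite) simp
    then show "A = line_stab i k l"
      using card_subset_eq[OF _ A(2)] card card_line_stab[OF assms] by metis
  qed
  then show ?thesis
    using line_stab_neq_carrier[OF assms] by (auto simp: maximal_subgroup_def)
qed

text \<open>
  Conjugation by a rotation multiplies the translations along the line by a cube root of unity other
  than \<open>1\<close>.
\<close>

lemma line_stab_not_commutative:
  assumes "int n dvd 1 + i + i ^ 2"
  shows "\<not> comm_group (G\<lparr>carrier := line_stab i k l\<rparr>)"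
proof
  assume "comm_group (G\<lparr>carrier := line_stab i k l\<rparr>)"
  then interpret K: comm_group "G\<lparr>carrier := line_stab i k l\<rparr>" .
  have "tr 1 i \<otimes> pt_rot k l = pt_rot k l \<otimes> tr 1 i"
    using K.m_comm[of "tr 1 i" "pt_rot k l"] tr_in_line_stab pt_rot_in_line_stab by simp
  then have "int n dvd 1 - i"
    by (simp add: pt_rot_def rot_eq_iff cong_iff_dvd_diff)
  then show False
    using not_dvd_slope_minus_1[OF assms] by blast
qed

text \<open>
  A subgroup with a rotation \<open>r\<close> is determined by \<open>r\<close> and its translations.  The latter form a subspace,
  which is either zero, or everything, or an \<open>R\<close>-invariant line.  In the last case the centre of \<open>r\<close> may
  be moved along the line to the point \<open>(0, l - ik)\<close>.
\<close>

lemma subgroup_cases: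
  assumes A: "subgroup A G"
  obtains "A = {\<one>}" | "A = carrier G" | "A = translation_group"
    | (line) k l where "tr k l \<noteq> \<one>" "A = line k l"
    | (stab) k l where "k < n" "l < n" "A = stab (int k) (int l)"
    | (line_stab) i l where "i < n" "int n dvd 1 + int i + int i ^ 2" "l < n" "A = line_stab (int i) 0 (int l)"
proof (cases "A \<subseteq> translation_group")
  case True
  then show ?thesis
    using subgroup_of_translations_cases[OF A] that(1,3,4) by metis
next
  case False
  then obtain k l where kl: "k < n" "l < n" "pt_rot (int k) (int l) \<in> A"
    using pt_rot_in_if_not_translation[OF A] by blast
  have recover: "A \<subseteq> B"
    if "subgroup B G" "pt_rot (int k) (int l) \<in> B" "A \<inter> translation_group \<subseteq> B" for B
    using that kl A subgroup_subset_of_common_rotation unfolding pt_rot_def by metis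
  have "subgroup (A \<inter> translation_group) G"
    by (rule subgroups_Inter_pair[OF A subgroup_translations])
  then show ?thesis
  proof (cases rule: subgroup_of_translations_cases)
    assume "A \<inter> translation_group = {\<one>}"
    then have "A \<subseteq> stab (int k) (int l)"
      using subgroup.one_closed[OF subgroup_stab] by (intro recover) auto
    then show ?thesis
      using that(5) kl stab_subset_iff[OF A] by blast
  next
    assume "A \<inter> translation_group = translation_group"
    then have "A = carrier G"
      using subgroup_eq_carrier[OF A] kl(3) unfolding pt_rot_def by blast
    then show ?thesis by (rule that(2))
  next
    fix u v assume uv: "tr u v \<noteq> \<one>" and A_Int: "A \<inter> translation_group = line u v"
    show ?thesis
    proof (cases "\<exists>i<n. line u v = line 1 (int i) \<and> int n dvd 1 + int i + int i ^ 2")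
      case True
      then obtain i where i: "i < n" "line u v = line 1 (int i)" "int n dvd 1 + int i + int i ^ 2"
        by blast
      have "line 1 (int i) \<subseteq> A"
        using A_Int i(2) by blast
      then have "line_stab (int i) (int k) (int l) \<subseteq> A"
        using kl(3) A tr_in_line by (intro line_stab_subset) auto
      moreover have "A \<subseteq> line_stab (int i) (int k) (int l)"
        using A_Int i(2) pt_rot_in_line_stab line_subset_line_stab by (intro recover) auto
      (* The line of slope i through (k, l) passes through (0, l - ik). *)
      moreover define l' where "l' = nat ((int l - int i * int k) mod int n)"
      have l': "int l' = (int l - int i * int k) mod int n"
        using n_gt_1 by (simp add: l'_def)
      then have "l' < n"
        using n_gt_1 by (simp add: l'_def nat_less_iff)
      have "int n dvd (int l - int i * int k) - int l'"
        unfolding l' by (simp add: minus_mod_eq_mult_div)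
      then have "line_stab (int i) (int k) (int l) = line_stab (int i) 0 (int l')"
        using i(3) by (simp add: line_stab_eq_iff algebra_simps)
      ultimately show ?thesis
        using that(6)[of i l'] i \<open>l' < n\<close> by simp
    next
      case False
      from uv have "A = carrier G"
      proof (cases rule: line_slope)
        case (slope i)
        then have "tr 1 (int i) \<in> A"
          using A_Int tr_in_line by blast
        then show ?thesis
          using eq_carrier_of_orbit[OF A kl(3)] False slope by auto
      next
        case vertical
        then have "tr 0 1 \<in> A"
          using A_Int tr_in_line by blast
        moreover have "\<not> int n dvd 0 ^ 2 + 0 * 1 + 1 ^ 2"
          using n_gt_1 by simp
        ultimately show ?thesis
          by (rule eq_carrier_of_orbit[OF A kl(3)])
      qed
      then show ?thesis by (rule that(2))
    qed
  qed simp
qed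

lemma join_distinct_lines:
  assumes "\<not> int n dvd k * v - l * u"
  shows "subgroup_join G (line k l) (line u v) = translation_group"
proof
  let ?J = "subgroup_join G (line k l) (line u v)"
  have "tr k l \<in> ?J" "tr u v \<in> ?J"
    by (rule subsetD[OF subgroup_join_upper(1) tr_in_line] subsetD[OF subgroup_join_upper(2) tr_in_line])+
  then show "translation_group \<subseteq> ?J"
    by (rule translations_subset_of_basis[OF subgroup_subgroup_join[OF subgroup_line subgroup_line]])
      (simp add: assms coprime_n_iff)
qed (intro subgroup_join_least subgroup_translations line_subset)

lemma join_noninvariant_line_stab:
  assumes "\<not> int n dvd k ^ 2 + k * l + l ^ 2"
  shows "subgroup_join G (line k l) (stab u v) = carrier G"
proof -
  let ?J = "subgroup_join G (line k l) (stab u v)"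
  have "tr k l \<in> ?J" "pt_rot u v \<in> ?J"
    by (rule subsetD[OF subgroup_join_upper(1) tr_in_line] subsetD[OF subgroup_join_upper(2) pt_rot_in_stab])+
  then show ?thesis
    using eq_carrier_of_orbit[OF subgroup_subgroup_join[OF subgroup_line subgroup_stab]] assms by blast
qed

context
  fixes k l k' l' :: int
  assumes distinct: "\<not> (int n dvd k' - k \<and> int n dvd l' - l)"
begin

text \<open>
  The vector is \<open>d - R d\<close> for the difference \<open>d\<close> of the two centres, and \<open>1 - R\<close> is injective.
\<close>

lemma translation_between_neq_one:
  "tr (2 * (k' - k) + (l' - l)) ((l' - l) - (k' - k)) \<noteq> \<one>"
proof
  let ?dk = "k' - k" and ?dl = "l' - l"
  assume "tr (2 * ?dk + ?dl) (?dl - ?dk) = \<one>"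
  then have 1: "int n dvd 2 * ?dk + ?dl" and 2: "int n dvd ?dl - ?dk"
    by (simp_all add: tr_eq_one_iff)
  have "int n dvd 3 * ?dk" "int n dvd 3 * ?dl"
    using dvd_diff[OF 1 2] dvd_add[OF 1 dvd_mult[OF 2, of 2]] by (simp_all add: algebra_simps)
  then show False
    using distinct not_n_dvd_3 by (simp only: prime_dvd_mult_iff[OF prime_int_n] simp_thms)
qed

lemma pt_rots_in_join:
  "pt_rot k l \<in> subgroup_join G (stab k l) (stab k' l')"
  "pt_rot k' l' \<in> subgroup_join G (stab k l) (stab k' l')"
  by (rule subsetD[OF subgroup_join_upper(1) pt_rot_in_stab] subsetD[OF subgroup_join_upper(2) pt_rot_in_stab])+

lemma translation_between_in_join:
  "tr (2 * (k' - k) + (l' - l)) ((l' - l) - (k' - k)) \<in> subgroup_join G (stab k l) (stab k' l')"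
  unfolding inv_pt_rot_mult_pt_rot[symmetric]
  by (intro subgroup.m_closed subgroup.m_inv_closed subgroup_subgroup_join subgroup_stab pt_rots_in_join)

text \<open>
  If the line through the two centres has the invariant slope \<open>i\<close>, then the quotient of the two rotations
  is a non-trivial translation along that line, and it generates all of them.
\<close>

lemma join_stabs_eq_line_stab_iff:
  assumes "int n dvd 1 + i + i ^ 2"
  shows "subgroup_join G (stab k l) (stab k' l') = line_stab i k l \<longleftrightarrow>
    int n dvd (l' - l) - i * (k' - k)"
proof
  assume "subgroup_join G (stab k l) (stab k' l') = line_stab i k l"
  then show "int n dvd (l' - l) - i * (k' - k)"
    using pt_rots_in_join pt_rot_in_line_stab_iff[OF assms] by simp
next
  let ?J = "subgroup_join G (stab k l) (stab k' l')"
  let ?w = "tr (2 * (k' - k) + (l' - l)) ((l' - l) - (k' - k))"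
  assume "int n dvd (l' - l) - i * (k' - k)"
  then have sub: "?J \<subseteq> line_stab i k l"
    by (intro subgroup_join_least)
      (simp_all add: stab_subset_line_stab stab_subset_iff pt_rot_in_line_stab_iff[OF assms])
  then have "?w \<in> line 1 i"
    using translation_between_in_join unfolding line_stab_Int_translations[OF assms, of k l, symmetric]
    by (intro IntI tr_in_translations) (rule subsetD)
  have J: "subgroup ?J G"
    by (intro subgroup_subgroup_join subgroup_stab)
  have "line 1 i = line (2 * (k' - k) + (l' - l)) ((l' - l) - (k' - k))"
    using \<open>?w \<in> line 1 i\<close> translation_between_neq_one by (simp add: line_eq_iff tr_in_line_iff)
  also have "\<dots> \<subseteq> ?J"
    using translation_between_in_join by (simp add: line_subset_iff[OF J])
  finally have "tr 1 i \<in> ?J"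
    using tr_in_line by blast
  then have "line_stab i k l \<subseteq> ?J"
    by (intro line_stab_subset J pt_rots_in_join)
  then show "?J = line_stab i k l"
    using sub by blast
qed

text \<open>
  The form \<open>k\<^sup>2 + kl + l\<^sup>2\<close> takes on \<open>d - R d\<close> three times its value on \<open>d\<close>.  That value vanishes only
  if \<open>d\<close> lies on an invariant line.
\<close>

lemma join_stabs_eq_carrier:
  assumes none: "\<And>i. i < n \<Longrightarrow> int n dvd 1 + int i + int i ^ 2 \<Longrightarrow>
      \<not> int n dvd (l' - l) - int i * (k' - k)"
  shows "subgroup_join G (stab k l) (stab k' l') = carrier G"
proof (rule eq_carrier_of_orbit[OF _ pt_rots_in_join(1) translation_between_in_join])
  define dk dl where "dk = k' - k" and "dl = l' - l"
  have neq: "tr dk dl \<noteq> \<one>"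
    using distinct by (simp add: tr_eq_one_iff dk_def dl_def)
  have "\<not> int n dvd dk ^ 2 + dk * dl + dl ^ 2"
  proof
    assume norm: "int n dvd dk ^ 2 + dk * dl + dl ^ 2"
    from neq show False
    proof (cases rule: line_slope)
      case vertical
      then have dk: "int n dvd dk"
        using neq by (simp add: line_eq_iff)
      have "int n dvd (dk ^ 2 + dk * dl + dl ^ 2) - (dk + dl) * dk"
        by (rule dvd_diff[OF norm dvd_mult[OF dk]])
      then have "int n dvd dl * dl"
        by (simp add: algebra_simps power2_eq_square)
      then show False
        using dk neq by (simp add: prime_dvd_mult_iff[OF prime_int_n] tr_eq_one_iff)
    next
      case (slope i)
      then have "int n dvd dk * int i - dl"
        using neq by (simp add: line_eq_iff)
      then have dl: "int n dvd dl - int i * dk"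
        by (metis dvd_minus_iff minus_diff_eq mult.commute)
      have "int n dvd (dk ^ 2 + dk * dl + dl ^ 2) - (dk + dl + int i * dk) * (dl - int i * dk)"
        by (rule dvd_diff[OF norm dvd_mult[OF dl]])
      also have "\<dots> = dk * (dk * (1 + int i + int i ^ 2))"
        by (simp add: algebra_simps power2_eq_square)
      finally have "int n dvd dk \<or> int n dvd 1 + int i + int i ^ 2"
        by (simp add: prime_dvd_mult_iff[OF prime_int_n])
      moreover have "\<not> int n dvd dk"
      proof
        assume dk: "int n dvd dk"
        then have "int n dvd (dl - int i * dk) + int i * dk"
          by (intro dvd_add[OF dl dvd_mult])
        then show False
          using dk neq by (simp add: tr_eq_one_iff)
      qed
      ultimately show False
        using none[OF slope(1)] dl by (simp add: dk_def dl_def)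
    qed
  qed
  moreover have "(2 * dk + dl) ^ 2 + (2 * dk + dl) * (dl - dk) + (dl - dk) ^ 2 = 3 * (dk ^ 2 + dk * dl + dl ^ 2)"
    by (simp add: algebra_simps power2_eq_square)
  ultimately show "\<not> int n dvd (2 * (k' - k) + (l' - l))\<^sup>2
      + (2 * (k' - k) + (l' - l)) * (l' - l - (k' - k)) + (l' - l - (k' - k))\<^sup>2"
    using not_n_dvd_3 unfolding dk_def dl_def
    by (simp only: prime_dvd_mult_iff[OF prime_int_n] simp_thms)
qed (intro subgroup_subgroup_join subgroup_stab)

end

end

section \<open>The subgroups of the presented group\<close>

lemma triangle_group_prime_grp:
  assumes "prime p" "3 < p"
  shows "triangle_group_prime (grp p) p (gx p) (x2y p) (xy2 p)"
  using assms triangle_group_grp[of p] by (simp add: triangle_group_prime_def triangle_group_prime_axioms_def)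

context
  fixes p :: nat
  assumes p: "prime p" "3 < p"
begin

interpretation triangle_group_prime "grp p" p "gx p" "x2y p" "xy2 p"
  using p by (rule triangle_group_prime_grp)

text \<open>
  This and the next lemmas identify the subgroups of the presented group with the geometric objects.
\<close>

lemma H_sub_eq: "H_sub p = translation_group"
proof
  show "H_sub p \<subseteq> translation_group"
    unfolding H_sub_def
    by (rule generate_subgroup_incl[OF _ subgroup_translations])
      (use tr_in_translations[of 1 0] tr_in_translations[of 0 1] in \<open>simp add: tr_1_0 tr_0_1\<close>)
  have sub: "subgroup (H_sub p) (grp p)"
    unfolding H_sub_def by (rule generate_is_subgroup) simp
  show "translation_group \<subseteq> H_sub p"
    by (rule translations_subset_of_basis[OF sub, of 1 0 0 1])
      (auto simp: tr_1_0 tr_0_1 H_sub_def intro: generate.incl)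
qed

lemma H_cyc_enat: "H_cyc p (enat i) = line 1 (int i)"
  by (simp add: H_cyc_def h_elt_def line_def tr_def int_pow_int)

lemma H_cyc_infinity: "H_cyc p \<infinity> = line 0 1"
  by (simp add: H_cyc_def h_elt_def line_def tr_def)

lemma G_cyc_eq: "G_cyc p k l = stab (int k) (int l)"
proof -
  have "g_elt p k l = pt_rot (int k) (int l)"
    unfolding g_elt_def pt_rot_eq_conj tr_def by (simp add: m_assoc int_pow_int)
  then show ?thesis
    by (simp add: G_cyc_def stab_def)
qed

lemma K_sub_eq: "K_sub p i l = line_stab (int i) 0 (int l)"
  by (simp add: K_sub_def line_stab_def H_cyc_enat G_cyc_eq)

lemma indices_cases:
  assumes "i \<in> indices p"
  obtains j where "i = enat j" "j < p" | "i = \<infinity>"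
  using assms by (auto simp: indices_def)

lemma cube_root_dvd: "i \<in> cube_roots p \<longleftrightarrow> i < p \<and> int p dvd 1 + int i + int i ^ 2"
  using cube_root_iff[OF p, of i] by (auto simp: cube_roots_def)

lemma line_in_H_cycs: "tr k l \<noteq> \<one>\<^bsub>grp p\<^esub> \<Longrightarrow> line k l \<in> H_cycs p"
  by (erule line_slope) (auto simp: H_cycs_def indices_def simp flip: H_cyc_enat H_cyc_infinity)

lemma H_cyc_is_line:
  assumes "i \<in> indices p"
  obtains k l where "tr k l \<noteq> \<one>\<^bsub>grp p\<^esub>" "H_cyc p i = line k l"
  using assms by (rule indices_cases) (use that tr_1_neq_one tr_0_1_neq_one H_cyc_enat H_cyc_infinity in blast)+

lemma subgroup_iff: "subgroup A (grp p) \<longleftrightarrow> A \<in> standard_subgroups p \<union> K_subs p"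
proof
  assume "subgroup A (grp p)"
  then show "A \<in> standard_subgroups p \<union> K_subs p"
  proof (cases A rule: subgroup_cases)
    case (stab k l)
    then show ?thesis
      by (auto simp: standard_subgroups_def G_cycs_def simp flip: G_cyc_eq)
  next
    case (line_stab i l)
    then have "A = K_sub p i l" "i \<in> cube_roots p"
      by (simp_all add: K_sub_eq cube_root_dvd)
    then show ?thesis
      using line_stab(3) by (auto simp: K_subs_def)
  qed (auto simp: standard_subgroups_def H_sub_eq line_in_H_cycs)
next
  assume "A \<in> standard_subgroups p \<union> K_subs p"
  then consider "A = {\<one>\<^bsub>grp p\<^esub>}" | "A = carrier (grp p)" | "A = H_sub p"
    | i where "A = H_cyc p i" "i \<in> indices p" | k l where "A = G_cyc p k l" | i l where "A = K_sub p i l"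
    by (auto simp: standard_subgroups_def H_cycs_def G_cycs_def K_subs_def)
  then show "subgroup A (grp p)"
  proof cases
    case 4
    then show ?thesis
      using H_cyc_is_line by (metis subgroup_line)
  qed (simp_all add: triv_subgroup subgroup_self H_sub_eq subgroup_translations G_cyc_eq K_sub_eq)
qed

lemma subgroups_eq: "{A. subgroup A (grp p)} = standard_subgroups p \<union> K_subs p"
  using subgroup_iff by blast

lemma subgroups_eq_standard:
  assumes "\<not> 3 dvd p - 1"
  shows "{A. subgroup A (grp p)} = standard_subgroups p"
  using subgroups_eq cube_roots_empty[OF p assms] by (simp add: K_subs_def)

lemma card_H_cyc: "i \<in> indices p \<Longrightarrow> card (H_cyc p i) = p"
  using H_cyc_is_line card_line by metis

lemma card_G_cyc: "card (G_cyc p k l) = 3"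
  by (simp add: G_cyc_eq card_stab)

lemma card_K_sub: "i \<in> cube_roots p \<Longrightarrow> card (K_sub p i l) = 3 * p"
  by (simp add: K_sub_eq card_line_stab cube_root_dvd)

text \<open>
  The listed groups have prime order.  Every other subgroup of the classification, except the trivial
  one, contains a line.
\<close>

lemma minimal_subgroups: "{A. minimal_subgroup A (grp p)} = H_cycs p \<union> G_cycs p"
proof
  show "H_cycs p \<union> G_cycs p \<subseteq> {A. minimal_subgroup A (grp p)}"
  proof
    fix A assume "A \<in> H_cycs p \<union> G_cycs p"
    then have "subgroup A (grp p)" "prime (card A)"
      using p card_H_cyc card_G_cyc
      by (auto simp: subgroup_iff standard_subgroups_def H_cycs_def G_cycs_def)
    then show "A \<in> {A. minimal_subgroup A (grp p)}"
      by (simp add: minimal_subgroup_if_prime_card)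
  qed
  show "{A. minimal_subgroup A (grp p)} \<subseteq> H_cycs p \<union> G_cycs p"
  proof
    fix A assume "A \<in> {A. minimal_subgroup A (grp p)}"
    then have A: "subgroup A (grp p)" "A \<noteq> {\<one>\<^bsub>grp p\<^esub>}"
      and minimal: "\<And>B. subgroup B (grp p) \<Longrightarrow> B \<subseteq> A \<Longrightarrow> B = {\<one>\<^bsub>grp p\<^esub>} \<or> B = A"
      by (auto simp: minimal_subgroup_def)
    have lineI: "A \<in> H_cycs p" if "line k l \<subseteq> A" "tr k l \<noteq> \<one>\<^bsub>grp p\<^esub>" for k l
      using minimal[OF subgroup_line that(1)] line_in_H_cycs[OF that(2)] tr_in_line[of k l] that(2)
      by auto
    have tr_1: "line 1 i \<subseteq> A \<Longrightarrow> A \<in> H_cycs p" for i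
      by (rule lineI[OF _ tr_1_neq_one])
    from A(1) show "A \<in> H_cycs p \<union> G_cycs p"
    proof (cases A rule: subgroup_cases)
      case 2
      then show ?thesis
        using tr_1[of 0] subgroup.subset[OF subgroup_line[of 1 0]] by simp
    next
      case 3
      then show ?thesis
        using tr_1[of 0] line_subset[of 1 0] by simp
    next
      case (line k l)
      then show ?thesis
        using line_in_H_cycs by simp
    next
      case (stab k l)
      then show ?thesis
        by (auto simp: G_cycs_def G_cyc_eq)
    next
      case (line_stab i l)
      then show ?thesis
        using tr_1[of "int i"] line_subset_line_stab[of "int i" 0 "int l"] by simp
    qed (use A(2) in simp)
  qed
qed

lemma H_cyc_iso:
  assumes "i \<in> indices p"
  shows "(grp p)\<lparr>carrier := H_cyc p i\<rparr> \<cong> integer_mod_group p"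
proof -
  obtain k l where "tr k l \<noteq> \<one>\<^bsub>grp p\<^esub>" and line: "H_cyc p i = line k l"
    using assms by (rule H_cyc_is_line)
  then have "ord (tr k l) = p"
    by (intro ord_tr)
  then show ?thesis
    using generate_singleton_iso_integer_mod_group[OF tr_closed, of k l] p by (simp add: line line_def)
qed

lemma G_cyc_iso: "(grp p)\<lparr>carrier := G_cyc p k l\<rparr> \<cong> integer_mod_group 3"
  using generate_singleton_iso_integer_mod_group[OF pt_rot_closed, of "int k" "int l"]
  by (simp add: ord_pt_rot G_cyc_eq stab_def)

lemma H_sub_iso: "(grp p)\<lparr>carrier := H_sub p\<rparr> \<cong> integer_mod_group p \<times>\<times> integer_mod_group p"
proof -
  let ?Z = "integer_mod_group p \<times>\<times> integer_mod_group p"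
  let ?H = "(grp p)\<lparr>carrier := H_sub p\<rparr>"
  let ?f = "\<lambda>(k, l). tr k l"
  have carrier: "carrier ?Z = {0..<int p} \<times> {0..<int p}"
    using p by (simp add: DirProd_def carrier_integer_mod_group)
  have "tr ((k + k') mod int p) ((l + l') mod int p) = tr (k + k') (l + l')" for k k' l l'
    by (rule tr_cong) (simp_all add: cong_def)
  then have hom: "?f \<in> hom ?Z ?H"
    unfolding hom_def carrier by (auto simp: H_sub_eq DirProd_def)
  have inj: "inj_on ?f (carrier ?Z)"
    unfolding carrier by (auto simp: inj_on_def tr_eq_iff cong_def)
  have "?f ` carrier ?Z = translation_group"
  proof (rule card_subset_eq[OF finite_translations])
    show "card (?f ` carrier ?Z) = card translation_group"
      unfolding card_image[OF inj] unfolding carrier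
      by (simp add: card_translations card_cartesian_product)
  qed auto
  then have "?f \<in> iso ?Z ?H"
    using inj hom by (simp add: iso_def bij_betw_def H_sub_eq)
  moreover have "group ?Z"
    by (intro DirProd_group group_integer_mod_group)
  ultimately show ?thesis
    using group.iso_sym by (auto simp: is_iso_def)
qed

lemma join_H_cyc_H_cyc:
  assumes "i \<in> indices p" "j \<in> indices p" "i \<noteq> j"
  shows "subgroup_join (grp p) (H_cyc p i) (H_cyc p j) = H_sub p"
proof -
  have not_unit: "\<not> int p dvd 1" and p_neq_1: "p \<noteq> Suc 0"
    using p by simp_all
  have slopes: "\<not> int p dvd int l - int k" if "k < p" "l < p" "k \<noteq> l" for k l
    using that by (simp add: cong_int_iff cong_def flip: cong_iff_dvd_diff)
  from assms show ?thesis
    by (elim indices_cases)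
      (auto simp: H_cyc_enat H_cyc_infinity H_sub_eq slopes not_unit p_neq_1 intro!: join_distinct_lines)
qed

text \<open>
  The orders are different: \<open>3p\<close> is none of \<open>1\<close>, \<open>3\<close>, \<open>p\<close>, \<open>p\<^sup>2\<close>, \<open>3p\<^sup>2\<close>.
\<close>

lemma standard_Int_K_subs: "standard_subgroups p \<inter> K_subs p = {}"
proof -
  have "card A \<noteq> 3 * p" if "A \<in> standard_subgroups p" for A
  proof -
    have "card A = 1 \<or> card A = 3 * p * p \<or> card A = p * p \<or> card A = p \<or> card A = 3"
      using that order_G card_translations card_H_cyc card_G_cyc
      by (auto simp: standard_subgroups_def H_cycs_def G_cycs_def H_sub_eq order_def)
    then show ?thesis
      using p by auto
  qed
  then show ?thesis
    using card_K_sub by (auto simp: K_subs_def)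
qed

text \<open>
  The slope is recovered from the translations in the group, and then \<open>l\<close> from the point where the line
  meets the second axis.
\<close>

lemma K_sub_eq_iff:
  assumes "i \<in> cube_roots p" "j \<in> cube_roots p" "l < p" "m < p"
  shows "K_sub p i l = K_sub p j m \<longleftrightarrow> i = j \<and> l = m"
proof
  assume eq: "K_sub p i l = K_sub p j m"
  have ij: "i < p" "j < p" "int p dvd 1 + int i + int i ^ 2" "int p dvd 1 + int j + int j ^ 2"
    using assms by (simp_all add: cube_root_dvd)
  have "line 1 (int i) = line 1 (int j)"
    using eq line_stab_Int_translations[OF ij(3), of 0 "int l"] line_stab_Int_translations[OF ij(4), of 0 "int m"]
    by (simp add: K_sub_eq)
  then have "i = j"
    using ij(1,2) by (simp add: line_eq_iff cong_int_iff cong_def flip: cong_iff_dvd_diff)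
  moreover have "int p dvd int l - int m"
    using eq line_stab_eq_iff[OF ij(3), of 0 "int l" 0 "int m"] by (simp add: K_sub_eq \<open>i = j\<close>)
  ultimately show "i = j \<and> l = m"
    using assms(3,4) by (simp add: cong_int_iff cong_def flip: cong_iff_dvd_diff)
qed simp

lemma card_K_subs_of_slope:
  assumes "i \<in> cube_roots p"
  shows "card {K_sub p i l | l. l < p} = p"
proof -
  have "{K_sub p i l | l. l < p} = K_sub p i ` {..<p}"
    by auto
  moreover have "inj_on (K_sub p i) {..<p}"
    using K_sub_eq_iff[OF assms assms] by (auto simp: inj_on_def)
  ultimately show ?thesis
    by (simp add: card_image)
qed

lemma card_K_subs:
  assumes "3 dvd p - 1"
  shows "card (K_subs p) = 2 * p"
proof -
  have "K_subs p = (\<lambda>(i, l). K_sub p i l) ` (cube_roots p \<times> {..<p})"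
    by (auto simp: K_subs_def)
  moreover have "inj_on (\<lambda>(i, l). K_sub p i l) (cube_roots p \<times> {..<p})"
    using K_sub_eq_iff by (auto simp: inj_on_def)
  ultimately show ?thesis
    using card_cube_roots[OF p assms] by (simp add: card_image card_cartesian_product)
qed

lemma K_sub_properties:
  assumes "A \<in> K_subs p"
  shows "\<not> comm_group ((grp p)\<lparr>carrier := A\<rparr>)" "maximal_subgroup A (grp p)" "card A = 3 * p"
  using assms line_stab_not_commutative maximal_line_stab card_line_stab
  by (auto simp: K_subs_def K_sub_eq cube_root_dvd)

lemma join_H_cyc_G_cyc_eq_K_sub_iff:
  assumes "i \<in> cube_roots p"
  shows "subgroup_join (grp p) (H_cyc p (enat i)) (G_cyc p k' l') = K_sub p i l \<longleftrightarrow>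
    [int l' - int l = int i * int k'] (mod int p)"
  using line_stab_eq_iff[of "int i" "int k'" "int l'" 0 "int l"] assms
  by (simp add: H_cyc_enat G_cyc_eq K_sub_eq cube_root_dvd cong_iff_dvd_diff flip: line_stab_def)

lemma join_H_cyc_G_cyc_eq_carrier:
  assumes "i \<in> indices p - enat ` cube_roots p"
  shows "subgroup_join (grp p) (H_cyc p i) (G_cyc p k l) = carrier (grp p)"
proof -
  from assms have "i \<in> indices p" by blast
  then show ?thesis
  proof (cases rule: indices_cases)
    case (1 j)
    then have "\<not> int p dvd 1 ^ 2 + 1 * int j + int j ^ 2"
      using assms by (auto simp: cube_root_dvd)
    then show ?thesis
      unfolding 1 H_cyc_enat G_cyc_eq by (rule join_noninvariant_line_stab)
  next
    case 2
    have "\<not> int p dvd 0 ^ 2 + 0 * 1 + 1 ^ 2"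
      using p by simp
    then show ?thesis
      unfolding 2 H_cyc_infinity G_cyc_eq by (rule join_noninvariant_line_stab)
  qed
qed

lemma distinct_points:
  assumes "k < p" "l < p" "k' < p" "l' < p" "(k, l) \<noteq> (k', l')"
  shows "\<not> (int p dvd int k' - int k \<and> int p dvd int l' - int l)"
  using assms by (auto simp: cong_int_iff cong_def simp flip: cong_iff_dvd_diff)

lemma join_G_cyc_G_cyc_iff:
  assumes "k < p" "l < p" "k' < p" "l' < p" "(k, l) \<noteq> (k', l')" and "i \<in> cube_roots p"
  shows "subgroup_join (grp p) (G_cyc p k l) (G_cyc p k' l')
      = subgroup_join (grp p) (H_cyc p (enat i)) (G_cyc p k l) \<longleftrightarrow>
    [int l' - int l = (int k' - int k) * int i] (mod int p)"
  using join_stabs_eq_line_stab_iff[OF distinct_points[OF assms(1-5)], of "int i"] assms(6)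
  by (simp add: G_cyc_eq H_cyc_enat cube_root_dvd cong_iff_dvd_diff mult.commute flip: line_stab_def)

lemma join_G_cyc_G_cyc_eq_carrier:
  assumes "k < p" "l < p" "k' < p" "l' < p" "(k, l) \<noteq> (k', l')"
    and "\<nexists>i. i \<in> cube_roots p \<and> [int l' - int l = (int k' - int k) * int i] (mod int p)"
  shows "subgroup_join (grp p) (G_cyc p k l) (G_cyc p k' l') = carrier (grp p)"
  unfolding G_cyc_eq
  by (rule join_stabs_eq_carrier[OF distinct_points[OF assms(1-5)]])
    (use assms(6) in \<open>auto simp: cube_root_dvd cong_iff_dvd_diff mult.commute\<close>)

end

theorem theorem5:
  shows
    "(\<forall>p::nat. prime p \<and> 3 < p \<longrightarrow>
      ({A. minimal_subgroup A (grp p)} = H_cycs p \<union> G_cycs p \<and>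
       (\<forall>i\<in>indices p. (grp p)\<lparr>carrier := H_cyc p i\<rparr> \<cong> integer_mod_group p) \<and>
       (\<forall>k<p. \<forall>l<p. (grp p)\<lparr>carrier := G_cyc p k l\<rparr> \<cong> integer_mod_group 3) \<and>
       (\<forall>i\<in>indices p. \<forall>j\<in>indices p. i \<noteq> j \<longrightarrow>
          subgroup_join (grp p) (H_cyc p i) (H_cyc p j) = H_sub p) \<and>
       (grp p)\<lparr>carrier := H_sub p\<rparr> \<cong> integer_mod_group p \<times>\<times> integer_mod_group p) \<and>
      (\<not> 3 dvd p - 1 \<longrightarrow> {A. subgroup A (grp p)} = standard_subgroups p) \<and>
      (3 dvd p - 1 \<longrightarrow>
        {A. subgroup A (grp p)} = standard_subgroups p \<union> K_subs p \<and>
        standard_subgroups p \<inter> K_subs p = {} \<and>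
        card (K_subs p) = 2 * p \<and>
        (\<forall>i\<in>cube_roots p. card {K_sub p i l | l. l < p} = p) \<and>
        (\<forall>A\<in>K_subs p. \<not> comm_group ((grp p)\<lparr>carrier := A\<rparr>) \<and>
           maximal_subgroup A (grp p) \<and> card A = 3 * p)) \<and>
      (\<forall>k'<p. \<forall>l'<p.
        (\<forall>i\<in>cube_roots p. \<forall>l<p.
           subgroup_join (grp p) (H_cyc p (enat i)) (G_cyc p k' l') = K_sub p i l \<longleftrightarrow>
           [int l' - int l = int i * int k'] (mod int p)) \<and>
        (\<forall>i\<in>indices p - enat ` cube_roots p.
           subgroup_join (grp p) (H_cyc p i) (G_cyc p k' l') = carrier (grp p))) \<and>
      (\<forall>k<p. \<forall>l<p. \<forall>k'<p. \<forall>l'<p. (k, l) \<noteq> (k', l') \<longrightarrow>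
        (\<forall>i\<in>cube_roots p.
           subgroup_join (grp p) (G_cyc p k l) (G_cyc p k' l')
             = subgroup_join (grp p) (H_cyc p (enat i)) (G_cyc p k l) \<longleftrightarrow>
           [int l' - int l = (int k' - int k) * int i] (mod int p)) \<and>
        ((\<nexists>i. i \<in> cube_roots p \<and> [int l' - int l = (int k' - int k) * int i] (mod int p)) \<longrightarrow>
           subgroup_join (grp p) (G_cyc p k l) (G_cyc p k' l') = carrier (grp p)))) \<and>
     grp 2 \<cong> alt_group 4 \<and>
     nonabelian_27_exp_3 (grp 3) \<and>
     (\<forall>K :: ('a, 'b) monoid_scheme. nonabelian_27_exp_3 K \<longrightarrow> grp 3 \<cong> K)"
  by (intro conjI allI impI ballI; (elim conjE)?)
    (rule grp_2_iso_alt_group nonabelian_27_exp_3_grp_3 grp_3_iso_if_nonabelian_27_exp_3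
      minimal_subgroups H_cyc_iso G_cyc_iso join_H_cyc_H_cyc H_sub_iso
      subgroups_eq subgroups_eq_standard standard_Int_K_subs card_K_subs card_K_subs_of_slope
      K_sub_properties join_H_cyc_G_cyc_eq_K_sub_iff join_H_cyc_G_cyc_eq_carrier
      join_G_cyc_G_cyc_iff join_G_cyc_G_cyc_eq_carrier; assumption)+

end
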